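(* Let $\mathcal{G}$ be a strongly regular graph $\mathrm{srg}(v,k,\lambda,\mu)$ whose adjacency matrix has integer eigenvalues $k$, $\nu_2$ and $\nu_3$, where $\nu_2=\frac12(\lambda-\mu+\sqrt{\Delta})$, $\nu_3=\frac12(\lambda-\mu-\sqrt{\Delta})$ and $\Delta=(\lambda-\mu)^2+4(k-\mu)$. Let $\phi$ be an automorphism of order $n$ of $\mathcal{G}$. Let $f$ be the number of vertices fixed by $\phi$, and let $g$ be the number of vertices that are adjacent to their image under $\phi$. Let $c$ be the number of cycles in the disjoint cycle decomposition of $\phi$ as a permutation of the vertices, and let $c_l$ be the number of cycles of length $l$ in it. Let $\mu_{0}(\cdot)$ denote the Möbius function. Then for every integer $r$ there are non-negative integers $a_d$ and $b_d$, for all positive divisors $d$ of $n$, such that $$k-r+\sum_{d\mid n}a_d\,\mu_{0}(d)(\nu_2-r)+\sum_{d\mid n}b_d\,\mu_{0}(d)(\nu_3-r)=-rf+g .$$ Furthermore $a_1+b_1=c-1$, and $a_d+b_d=\sum_{d\mid l}c_l$ for every divisor $d\neq 1$ of $n$. As a consequence the following congruence holds: $$k-\nu_3\equiv-\nu_3f+g\pmod{\sqrt{\Delta}}.$$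
   Context: A strongly regular graph $\mathrm{srg}(v,k,\lambda,\mu)$ is a finite simple undirected graph, neither complete nor edgeless, with $v$ vertices, in which every vertex has exactly $k$ neighbours, any two adjacent vertices have exactly $\lambda$ common neighbours, and any two distinct non-adjacent vertices have exactly $\mu$ common neighbours. Its adjacency matrix has eigenvalues $k,\nu_2,\nu_3$, with $\nu_2-\nu_3=\sqrt{\Delta}$. Cycles of length $1$ (fixed vertices) are counted in the disjoint cycle decomposition of $\phi$; the sum $\sum_{d\mid l}c_l$ is over all cycle lengths $l$ divisible by $d$. The number $g$ does not count fixed vertices, since a vertex is not adjacent to itself. The Möbius function is written $\mu_0$ to distinguish it from the graph parameter $\mu$. *)

theory Defs
  imports
    Complex_Main
    "HOL-Combinatorics.Permutations"
    "HOL-Combinatorics.Orbits"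
    "HOL-Computational_Algebra.Squarefree"
    "HOL-Number_Theory.Cong"
    "Graph_Theory.Pair_Digraph"
    "Jordan_Normal_Form.Spectral_Radius"
begin

text \<open>
  A finite simple undirected graph is a \<^locale>\<open>pair_graph\<close>: a finite, loop-free digraph whose set
  of ordered pairs \<^const>\<open>parcs\<close> is symmetric.
\<close>

definition nbrs :: "'a pair_pre_digraph \<Rightarrow> 'a \<Rightarrow> 'a set" where
  "nbrs G u = {w \<in> pverts G. (u, w) \<in> parcs G}"

definition srg :: "'a pair_pre_digraph \<Rightarrow> nat \<Rightarrow> nat \<Rightarrow> nat \<Rightarrow> nat \<Rightarrow> bool" where
  "srg G v k l m \<longleftrightarrow>
     pair_graph G \<and>
     (\<exists>u \<in> pverts G. \<exists>w \<in> pverts G. u \<noteq> w \<and> (u, w) \<notin> parcs G) \<and>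
     parcs G \<noteq> {} \<and>
     card (pverts G) = v \<and>
     (\<forall>u \<in> pverts G. card (nbrs G u) = k) \<and>
     (\<forall>u \<in> pverts G. \<forall>w \<in> pverts G.
        (u, w) \<in> parcs G \<longrightarrow> card (nbrs G u \<inter> nbrs G w) = l) \<and>
     (\<forall>u \<in> pverts G. \<forall>w \<in> pverts G.
        u \<noteq> w \<and> (u, w) \<notin> parcs G \<longrightarrow> card (nbrs G u \<inter> nbrs G w) = m)"

text \<open>Rows and columns are indexed by the positions of the vertices in the list \<open>vs\<close>, which is
  meant to enumerate the vertex set without repetition.\<close>

definition adjacency_mat :: "'a pair_pre_digraph \<Rightarrow> 'a list \<Rightarrow> complex mat" where
  "adjacency_mat G vs = mat (length vs) (length vs)
     (\<lambda>(i, j). if (vs ! i, vs ! j) \<in> parcs G then 1 else 0)"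

text \<open>An automorphism is extended by the identity outside the vertex set, so that its powers can be
  compared with \<^const>\<open>id\<close>.\<close>

definition graph_aut :: "'a pair_pre_digraph \<Rightarrow> ('a \<Rightarrow> 'a) \<Rightarrow> bool" where
  "graph_aut G \<phi> \<longleftrightarrow>
     \<phi> permutes pverts G \<and>
     (\<forall>u \<in> pverts G. \<forall>w \<in> pverts G. (\<phi> u, \<phi> w) \<in> parcs G \<longleftrightarrow> (u, w) \<in> parcs G)"

definition perm_order :: "('a \<Rightarrow> 'a) \<Rightarrow> nat" where
  "perm_order \<phi> = (LEAST n. 0 < n \<and> \<phi> ^^ n = id)"

definition num_fixed :: "'a pair_pre_digraph \<Rightarrow> ('a \<Rightarrow> 'a) \<Rightarrow> nat" where
  "num_fixed G \<phi> = card {u \<in> pverts G. \<phi> u = u}"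

definition num_adj_image :: "'a pair_pre_digraph \<Rightarrow> ('a \<Rightarrow> 'a) \<Rightarrow> nat" where
  "num_adj_image G \<phi> = card {u \<in> pverts G. (u, \<phi> u) \<in> parcs G}"

text \<open>The cycles of a permutation are identified with their supports, the orbits; a fixed vertex
  \<open>u\<close> contributes the cycle \<open>{u}\<close> of length 1.\<close>

definition perm_cycles :: "'a pair_pre_digraph \<Rightarrow> ('a \<Rightarrow> 'a) \<Rightarrow> 'a set set" where
  "perm_cycles G \<phi> = orbit \<phi> ` pverts G"

definition num_cycles :: "'a pair_pre_digraph \<Rightarrow> ('a \<Rightarrow> 'a) \<Rightarrow> nat" where
  "num_cycles G \<phi> = card (perm_cycles G \<phi>)"

definition num_cycles_len :: "'a pair_pre_digraph \<Rightarrow> ('a \<Rightarrow> 'a) \<Rightarrow> nat \<Rightarrow> nat" where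
  "num_cycles_len G \<phi> l = card {C \<in> perm_cycles G \<phi>. card C = l}"

definition moebius :: "nat \<Rightarrow> int" where
  "moebius n = (if squarefree n then (- 1) ^ card (prime_factors n) else 0)"

end

theory Submission
  imports Defs "HOL-Combinatorics.Cycles" "HOL-Number_Theory.Residues"
begin

text \<open>
  Let \<open>P\<close> be the permutation matrix of \<open>\<phi>\<close> and \<open>A\<close> the adjacency matrix. They commute, so \<open>P\<close>
  preserves the constant vectors and the two eigenspaces \<open>V\<^sub>2\<close>, \<open>V\<^sub>3\<close> of \<open>A\<close> on the complement of the
  constant vectors. Since \<open>g - r f\<close> is the trace of \<open>P (A - r)\<close>, it equals
  \<open>(k - r) + (\<nu>\<^sub>2 - r) T\<^sub>2 + (\<nu>\<^sub>3 - r) T\<^sub>3\<close>, where \<open>T\<^sub>j\<close> is the trace of \<open>P\<close> on \<open>V\<^sub>j\<close>. As the eigenvalues are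
  integers, the projections onto \<open>V\<^sub>2\<close> and \<open>V\<^sub>3\<close> have rational entries, so the action of the cyclic
  group generated by \<open>\<phi>\<close> on \<open>V\<^sub>j\<close> has a rational character \<open>\<chi>\<^sub>j\<close>. The eigenvalues of \<open>P\<close> on \<open>V\<^sub>j\<close> are
  \<open>n\<close>-th roots of unity, and a rational character forces all primitive \<open>d\<close>-th roots of unity to have
  the same multiplicity. Calling it \<open>a\<^sub>d\<close> on \<open>V\<^sub>2\<close> and \<open>b\<^sub>d\<close> on \<open>V\<^sub>3\<close>, and using that the primitive \<open>d\<close>-th
  roots of unity add up to \<open>\<mu>\<^sub>0 d\<close>, one gets \<open>T\<^sub>2 = \<Sum> a\<^sub>d \<mu>\<^sub>0 d\<close> and \<open>T\<^sub>3 = \<Sum> b\<^sub>d \<mu>\<^sub>0 d\<close>. On the whole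
  space each cycle whose length is divisible by \<open>d\<close> contributes every primitive \<open>d\<close>-th root once, and
  the constant vectors use up one eigenvalue \<open>1\<close>; this gives the values of \<open>a\<^sub>d + b\<^sub>d\<close>. The
  congruence is the trace formula at \<open>r = \<nu>\<^sub>3\<close>, because \<open>\<nu>\<^sub>2 - \<nu>\<^sub>3 = \<surd>\<Delta>\<close> and \<open>T\<^sub>2\<close> is an integer.
\<close>

text \<open>
  Three facts carry the argument. The first, \<open>char_sum_rational_imp_const_on_order\<close>, is the Galois
  invariance of the multiplicities; it takes the place of the irreducibility of the cyclotomic
  polynomials and rests on the Frobenius congruence \<open>char_sum_frobenius_congruence\<close>. The second,
  \<open>invariant_idempotent_multiplicities\<close>, reads off the multiplicities from the traces of \<open>P\<^sup>i E\<close>, for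
  a projection \<open>E\<close> commuting with \<open>P\<close>, by triangularising \<open>P E\<close>. The third,
  \<open>srg_eigenspace_multiplicities\<close>, supplies the projections: the one onto \<open>V\<^sub>2\<close> is an explicit
  combination of \<open>A\<close>, the identity and the all-one matrix.
\<close>

section \<open>Integral combinations of roots of unity\<close>

lemma sum_powers_root_of_unity:
  fixes z :: complex
  assumes "z ^ n = 1"
  shows "(\<Sum>i<n. z ^ i) = (if z = 1 then of_nat n else 0)"
  using assms by (auto simp: geometric_sum)

lemma roots_of_unity_eq_powers:
  assumes "n > 0"
  shows "{z :: complex. z ^ n = 1} = (\<lambda>k. cis (2 * pi / real n) ^ k) ` {..<n}"
proof -
  have "(\<lambda>k. cis (2 * pi * real k / real n)) = (\<lambda>k. cis (2 * pi / real n) ^ k)"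
    by (auto simp: Complex.DeMoivre field_simps)
  then show ?thesis
    using bij_betw_imp_surj_on[OF bij_betw_roots_unity[OF assms]] by (simp only:)
qed

lemma cis_power_eq_1_iff:
  assumes "n > 0"
  shows "cis (2 * pi / real n) ^ j = 1 \<longleftrightarrow> n dvd j"
proof -
  let ?z = "cis (2 * pi / real n)"
  have eq: "?z ^ k = cis (2 * pi * real k / real n)" for k
    by (auto simp: Complex.DeMoivre field_simps)
  have zn: "?z ^ n = 1"
    using assms by (simp add: eq)
  have "?z ^ j = ?z ^ (n * (j div n) + j mod n)"
    by simp
  also have "\<dots> = ?z ^ (j mod n)"
    by (simp only: power_add power_mult zn power_one mult_1)
  finally have mod: "?z ^ j = ?z ^ (j mod n)" .
  have "inj_on (\<lambda>k. cis (2 * pi * real k / real n)) {..<n}"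
    using bij_betw_roots_unity[OF assms] by (simp add: bij_betw_def)
  then have "?z ^ (j mod n) = ?z ^ 0 \<longleftrightarrow> j mod n = 0"
    using assms by (subst (1 2) eq, subst inj_on_eq_iff) auto
  with mod show ?thesis
    by (simp add: mod_eq_0_iff_dvd)
qed

text \<open>
  The values of integer polynomials at \<open>z\<close> form the ring generated by \<open>z\<close>; it is spanned over the integers by
  finitely many powers, which is what makes its elements integral.
\<close>
lemma int_poly_at_root_of_unity:
  fixes z :: complex and f :: "int poly"
  assumes "n > 0" "z ^ n = 1"
  shows "\<exists>c. poly (of_int_poly f) z = (\<Sum>j<n. of_int (c j) * z ^ j)"
proof -
  have pow: "z ^ i = z ^ (i mod n)" for i
  proof -
    have "z ^ i = z ^ (n * (i div n) + i mod n)" by simp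
    then show ?thesis by (simp only: power_add power_mult assms(2) power_one mult_1)
  qed
  have "poly (of_int_poly f) z = (\<Sum>i\<le>degree f. of_int (Polynomial.coeff f i) * z ^ i)"
    by (simp add: poly_altdef)
  also have "\<dots> = (\<Sum>i\<le>degree f. of_int (Polynomial.coeff f i) * z ^ (i mod n))"
    using pow by simp
  also have "\<dots> = (\<Sum>j<n. \<Sum>i\<in>{i \<in> {..degree f}. i mod n = j}. of_int (Polynomial.coeff f i) * z ^ (i mod n))"
    by (rule sum.group[symmetric]) (use assms(1) in auto)
  also have "\<dots> = (\<Sum>j<n. of_int (\<Sum>i\<in>{i \<in> {..degree f}. i mod n = j}. Polynomial.coeff f i) * z ^ j)"
    by (intro sum.cong refl) (simp add: sum_distrib_right)
  finally show ?thesis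
    by (intro exI[of _ "\<lambda>j. \<Sum>i\<in>{i \<in> {..degree f}. i mod n = j}. Polynomial.coeff f i"])
qed

text \<open>
  Multiplication by \<open>x = f(z)\<close> maps the span of \<open>1, z, \<dots>, z\<^sup>n\<^sup>-\<^sup>1\<close> over the integers into itself, so \<open>x\<close> is an
  eigenvalue of an integer matrix, with eigenvector \<open>(1, z, \<dots>, z\<^sup>n\<^sup>-\<^sup>1)\<close>. Hence \<open>x\<close> is an algebraic
  integer, and a rational algebraic integer is an integer.
\<close>
lemma rational_int_poly_at_root_of_unity:
  fixes z :: complex and f :: "int poly"
  assumes n: "n > 0" and z: "z ^ n = 1" and rat: "poly (of_int_poly f) z \<in> \<rat>"
  shows "poly (of_int_poly f) z \<in> \<int>"
proof -
  let ?x = "poly (of_int_poly f) z"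
  have "\<exists>c. ?x * z ^ i = (\<Sum>j<n. of_int (c j) * z ^ j)" for i
    using int_poly_at_root_of_unity[OF n z, of "f * Polynomial.monom 1 i"]
    by (simp add: of_int_poly_hom.hom_mult poly_monom)
  then obtain C where C: "\<And>i. ?x * z ^ i = (\<Sum>j<n. of_int (C i j) * z ^ j)"
    by metis
  define M :: "int mat" where "M = mat n n (\<lambda>(i, j). C i j)"
  define u where "u = vec n (\<lambda>j. z ^ j)"
  have M: "M \<in> carrier_mat n n" by (simp add: M_def)
  have "map_mat of_int M *\<^sub>v u = ?x \<cdot>\<^sub>v u"
    by (rule eq_vecI) (auto simp: M_def u_def scalar_prod_def C atLeast0LessThan)
  moreover have "u \<noteq> 0\<^sub>v n"
  proof
    assume "u = 0\<^sub>v n"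
    then have "u $ 0 = 0" using n by simp
    then show False using n by (simp add: u_def)
  qed
  ultimately have "eigenvector (map_mat of_int M) u ?x"
    by (auto simp: eigenvector_def M_def u_def)
  then have "eigenvalue (map_mat of_int M) ?x"
    by (auto simp: eigenvalue_def)
  then have "poly (char_poly (map_mat of_int M)) ?x = 0"
    by (subst (asm) eigenvalue_root_char_poly[of _ n]) (use M in auto)
  then have "poly (of_int_poly (char_poly M)) ?x = 0"
    by (simp add: of_int_hom.char_poly_hom[OF M])
  moreover have "lead_coeff (char_poly M) = 1"
    using degree_monic_char_poly[OF M] by simp
  ultimately have "algebraic_int ?x"
    by (auto simp: algebraic_int_altdef_ipoly)
  then show ?thesis
    using rat by (rule rational_algebraic_int_is_int)
qed

lemma prime_dvd_add_power_diff:
  fixes x y :: "'a :: comm_ring_1"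
  assumes "prime p"
  shows "of_nat p dvd (x + y) ^ p - (x ^ p + y ^ p)"
proof -
  have p: "p > 0" using assms by (simp add: prime_gt_0_nat)
  have "(x + y) ^ p = (\<Sum>k\<le>p. of_nat (p choose k) * x ^ k * y ^ (p - k))"
    by (rule binomial_ring)
  also have "{..p} = insert 0 (insert p {0<..<p})"
    using p by auto
  also have "(\<Sum>k\<in>\<dots>. of_nat (p choose k) * x ^ k * y ^ (p - k))
    = y ^ p + (x ^ p + (\<Sum>k\<in>{0<..<p}. of_nat (p choose k) * x ^ k * y ^ (p - k)))"
    using p by (subst sum.insert; (subst sum.insert)?) auto
  finally have "(x + y) ^ p - (x ^ p + y ^ p)
      = (\<Sum>k\<in>{0<..<p}. of_nat (p choose k) * x ^ k * y ^ (p - k))"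
    by simp
  also have "of_nat p dvd \<dots>"
  proof (rule dvd_sum)
    fix k assume "k \<in> {0<..<p}"
    then have "p dvd (p choose k)"
      using assms by (intro dvd_choose_prime) auto
    then have "(of_nat p :: 'a) dvd of_nat (p choose k)"
      by (auto simp: dvd_def)
    then show "of_nat p dvd of_nat (p choose k) * x ^ k * y ^ (p - k)"
      by (simp add: dvd_mult2)
  qed
  finally show ?thesis .
qed

text \<open>
  Fermat's little theorem, by induction on \<open>a\<close>: the two sides change by the same amount modulo \<open>p\<close>
  when \<open>a\<close> increases by one.
\<close>
lemma prime_dvd_power_diff_int:
  fixes a :: int
  assumes "prime p"
  shows "int p dvd a ^ p - a"
proof -
  have step: "int p dvd (a + 1) ^ p - (a + 1) \<longleftrightarrow> int p dvd a ^ p - a" for a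
  proof -
    have "int p dvd ((a + 1) ^ p - (a + 1)) - (a ^ p - a)"
      using prime_dvd_add_power_diff[OF assms, of a 1] by (simp add: algebra_simps)
    then show ?thesis
      by (metis dvd_add_right_iff diff_add_cancel dvd_add)
  qed
  show ?thesis
  proof (induction a rule: int_induct[where k = 0])
    case base
    show ?case using assms by (simp add: prime_gt_0_nat power_0_left)
  next
    case (step1 i)
    then show ?case using step by blast
  next
    case (step2 i)
    then show ?case using step[of "i - 1"] by simp
  qed
qed

text \<open>
  Modulo \<open>p\<close>, the Frobenius map of integer polynomials is the substitution \<open>X \<mapsto> X\<^sup>p\<close>.
\<close>
lemma prime_dvd_power_minus_pcompose:
  fixes f :: "int poly"
  assumes "prime p"
  shows "of_nat p dvd f ^ p - pcompose f (Polynomial.monom 1 p)"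
proof (induction f)
  case 0
  show ?case using assms by (simp add: prime_gt_0_nat power_0_left)
next
  case (pCons a f)
  have eq: "pCons a f = [:a:] + Polynomial.monom 1 1 * f"
    by (simp add: monom_altdef)
  have "[:a:] ^ p - [:a:] = [:a ^ p - a:]"
    by (simp add: poly_const_pow)
  moreover have "of_nat p dvd [:a ^ p - a:]"
    using prime_dvd_power_diff_int[OF assms, of a]
    by (simp add: of_nat_poly const_poly_dvd)
  ultimately have 1: "of_nat p dvd [:a:] ^ p - [:a:]" by simp
  have 2: "of_nat p dvd Polynomial.monom 1 p * (f ^ p - pcompose f (Polynomial.monom 1 p))"
    using pCons.IH by (rule dvd_mult)
  have 3: "of_nat p dvd pCons a f ^ p - ([:a:] ^ p + (Polynomial.monom 1 1 * f) ^ p)"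
    unfolding eq by (rule prime_dvd_add_power_diff[OF assms])
  have "(Polynomial.monom 1 1 * f) ^ p = Polynomial.monom 1 p * f ^ p"
    by (simp only: power_mult_distrib monom_power mult_1 power_one)
  then have "pCons a f ^ p - pcompose (pCons a f) (Polynomial.monom 1 p)
     = (pCons a f ^ p - ([:a:] ^ p + (Polynomial.monom 1 1 * f) ^ p)) + (([:a:] ^ p - [:a:])
       + Polynomial.monom 1 p * (f ^ p - pcompose f (Polynomial.monom 1 p)))"
    by (simp only: pcompose_pCons) (simp add: algebra_simps)
  then show ?case
    using dvd_add[OF 3 dvd_add[OF 1 2]] by (simp only:)
qed

section \<open>Rational characters of a cyclic group\<close>

text \<open>
  The character of a cyclic group of order \<open>n\<close> on a space where a generator has the eigenvalue \<open>z\<close>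
  with multiplicity \<open>\<alpha> z\<close>, evaluated at the \<open>i\<close>-th power of the generator. Multiplicities may be
  negative because differences of multiplicity functions occur below.
\<close>
definition char_sum :: "nat \<Rightarrow> (complex \<Rightarrow> int) \<Rightarrow> nat \<Rightarrow> complex" where
  "char_sum n \<alpha> i = (\<Sum>z | z ^ n = 1. of_int (\<alpha> z) * z ^ i)"

lemma char_sum_rational_imp_int:
  assumes "n > 0" "char_sum n \<alpha> i \<in> \<rat>"
  shows "char_sum n \<alpha> i \<in> \<int>"
proof -
  define \<zeta> where "\<zeta> = cis (2 * pi / real n)"
  define k where "k z = (SOME k. z = \<zeta> ^ k)" for z
  have k: "z = \<zeta> ^ k z" if "z ^ n = 1" for z
  proof -
    have "z \<in> (\<lambda>k. \<zeta> ^ k) ` {..<n}"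
      using that unfolding \<zeta>_def roots_of_unity_eq_powers[OF assms(1), symmetric] by simp
    then show ?thesis
      unfolding k_def by (auto intro: someI)
  qed
  define f where "f = (\<Sum>z | z ^ n = 1. Polynomial.monom (\<alpha> z) (k z * i))"
  have "char_sum n \<alpha> i = (\<Sum>z | z ^ n = 1. of_int (\<alpha> z) * (\<zeta> ^ k z) ^ i)"
    unfolding char_sum_def by (intro sum.cong refl) (simp flip: k)
  also have "\<dots> = poly (of_int_poly f) \<zeta>"
    by (simp add: f_def of_int_poly_hom.hom_sum poly_sum poly_monom power_mult)
  finally have "char_sum n \<alpha> i = poly (of_int_poly f) \<zeta>" .
  moreover have "\<zeta> ^ n = 1"
    using assms(1) by (simp add: \<zeta>_def cis_power_eq_1_iff)
  ultimately show ?thesis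
    using rational_int_poly_at_root_of_unity[OF assms(1)] assms(2) by metis
qed

lemma char_sum_inversion:
  assumes n: "n > 0" and w: "w ^ n = 1"
  shows "(\<Sum>i<n. char_sum n \<alpha> i * inverse w ^ i) = of_nat n * of_int (\<alpha> w)"
proof -
  have w0: "w \<noteq> 0" using n w by (auto simp: power_0_left)
  have "(\<Sum>i<n. char_sum n \<alpha> i * inverse w ^ i)
      = (\<Sum>z | z ^ n = 1. \<Sum>i<n. of_int (\<alpha> z) * z ^ i * inverse w ^ i)"
    unfolding char_sum_def sum_distrib_right by (rule sum.swap)
  also have "\<dots> = (\<Sum>z | z ^ n = 1. of_int (\<alpha> z) * (\<Sum>i<n. (z / w) ^ i))"
    by (simp add: sum_distrib_left divide_inverse power_mult_distrib mult.assoc)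
  also have "\<dots> = (\<Sum>z | z ^ n = 1. if z = w then of_nat n * of_int (\<alpha> w) else 0)"
    by (intro sum.cong refl, subst sum_powers_root_of_unity)
      (use w w0 in \<open>auto simp: power_divide\<close>)
  also have "\<dots> = of_nat n * of_int (\<alpha> w)"
    using finite_roots_unity[of n, where 'a = complex] n w by simp
  finally show ?thesis .
qed

text \<open>
  By Fourier inversion, \<open>n \<alpha>(w) = f(\<zeta>)\<close> for an integer polynomial \<open>f\<close> whose coefficients are the
  values of the character, and \<open>n \<alpha>(w\<^sup>p) = f(\<zeta>\<^sup>p)\<close>. Since \<open>f(\<zeta>\<^sup>p) \<equiv> f(\<zeta>)\<^sup>p\<close> modulo \<open>p\<close>, Fermat's little
  theorem gives \<open>n \<alpha>(w\<^sup>p) \<equiv> n \<alpha>(w)\<close>, and \<open>n\<close> is invertible modulo \<open>p\<close>.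
\<close>
lemma char_sum_frobenius_congruence:
  assumes n: "n > 0" and p: "prime p" "coprime p n"
    and rat: "\<And>i. char_sum n \<alpha> i \<in> \<rat>" and w: "w ^ n = 1"
  shows "int p dvd \<alpha> (w ^ p) - \<alpha> w"
proof -
  define \<zeta> where "\<zeta> = cis (2 * pi / real n)"
  have zn: "\<zeta> ^ n = 1"
    using n by (simp add: \<zeta>_def cis_power_eq_1_iff)
  have "\<forall>i. \<exists>c. char_sum n \<alpha> i = of_int c"
    using char_sum_rational_imp_int[OF n rat] by (auto elim: Ints_cases)
  then obtain \<psi> where \<psi>: "\<And>i. char_sum n \<alpha> i = of_int (\<psi> i)"
    by metis
  have "inverse w ^ n = 1" using w by (simp add: power_inverse)
  then have "inverse w \<in> (\<lambda>k. \<zeta> ^ k) ` {..<n}"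
    unfolding \<zeta>_def roots_of_unity_eq_powers[OF n, symmetric] by simp
  then obtain k where k: "inverse w = \<zeta> ^ k"
    by auto
  define f where "f = (\<Sum>i<n. Polynomial.monom (\<psi> i) (k * i))"
  have f_eval: "poly (of_int_poly f) x = (\<Sum>i<n. of_int (\<psi> i) * (x ^ k) ^ i)" for x :: complex
    by (simp add: f_def of_int_poly_hom.hom_sum poly_sum poly_monom power_mult)
  have f1: "poly (of_int_poly f) \<zeta> = of_int (int n * \<alpha> w)"
    using char_sum_inversion[OF n w, of \<alpha>] by (simp add: f_eval \<psi> k)
  have f2: "poly (of_int_poly f) (\<zeta> ^ p) = of_int (int n * \<alpha> (w ^ p))"
  proof -
    have "(w ^ p) ^ n = (w ^ n) ^ p" by (simp flip: power_mult add: mult.commute)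
    then have "(w ^ p) ^ n = 1" using w by simp
    moreover have "(\<zeta> ^ p) ^ k = inverse (w ^ p)"
      by (simp flip: k power_mult add: power_inverse mult.commute[of p] power_mult)
    ultimately show ?thesis
      using char_sum_inversion[OF n, of "w ^ p" \<alpha>] by (simp add: f_eval \<psi>)
  qed
  obtain h where h: "f ^ p - pcompose f (Polynomial.monom 1 p) = of_nat p * h"
    using prime_dvd_power_minus_pcompose[OF p(1)] by (auto simp: dvd_def)
  have comp: "poly (of_int_poly (pcompose f (Polynomial.monom 1 p))) \<zeta> = poly (of_int_poly f) (\<zeta> ^ p)"
    by (simp add: of_int_hom.map_poly_pcompose poly_pcompose poly_monom)
  have h_eval: "of_int ((int n * \<alpha> w) ^ p - int n * \<alpha> (w ^ p)) = of_nat p * poly (of_int_poly h) \<zeta>"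
    using arg_cong[OF h, of "\<lambda>g. poly (of_int_poly g) \<zeta>"]
    by (simp add: of_int_poly_hom.hom_mult of_int_poly_hom.hom_minus of_int_poly_hom.hom_power
        of_int_poly_hom.hom_of_nat comp f1 f2)
  \<comment> \<open>The congruence so far holds in the ring generated by \<open>\<zeta>\<close>; as the cofactor is rational, it is an integer.\<close>
  have p0: "(of_nat p :: complex) \<noteq> 0" using p(1) by (simp add: prime_gt_0_nat)
  then have "poly (of_int_poly h) \<zeta> = of_int ((int n * \<alpha> w) ^ p - int n * \<alpha> (w ^ p)) / of_nat p"
    unfolding h_eval by simp
  then have "poly (of_int_poly h) \<zeta> \<in> \<rat>"
    by (metis Rats_divide Rats_of_int Rats_of_nat)
  then obtain t where "poly (of_int_poly h) \<zeta> = of_int t"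
    using rational_int_poly_at_root_of_unity[OF n zn] by (auto elim: Ints_cases)
  with h_eval have "(of_int ((int n * \<alpha> w) ^ p - int n * \<alpha> (w ^ p)) :: complex) = of_int (int p * t)"
    by simp
  then have "int p dvd (int n * \<alpha> w) ^ p - int n * \<alpha> (w ^ p)"
    by (simp only: of_int_eq_iff) simp
  then have "int p dvd ((int n * \<alpha> w) ^ p - int n * \<alpha> w) - ((int n * \<alpha> w) ^ p - int n * \<alpha> (w ^ p))"
    using prime_dvd_power_diff_int[OF p(1)] by (metis dvd_diff)
  then have "int p dvd int n * (\<alpha> (w ^ p) - \<alpha> w)"
    by (simp add: algebra_simps)
  then show ?thesis
    using p(2) by (simp add: coprime_dvd_mult_right_iff)
qed

lemma power_power_root_of_unity:
  fixes z :: complex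
  shows "z ^ n = 1 \<Longrightarrow> (z ^ k) ^ n = 1"
  by (metis power_mult mult.commute power_one)

text \<open>
  Put \<open>\<beta>(z) = (\<alpha>(z\<^sup>p) - \<alpha>(z)) / p\<close>. This is integer valued by the Frobenius congruence, and its
  character is again rational, because \<open>z \<mapsto> z\<^sup>p\<close> permutes the roots of unity. The oscillation of \<open>\<beta>\<close> is
  at most \<open>2/p\<close> times that of \<open>\<alpha>\<close>, hence smaller for odd \<open>p\<close>, so by induction \<open>\<beta>(w\<^sup>p) = \<beta>(w)\<close>. Then
  \<open>\<alpha>\<close> grows by the constant \<open>p \<beta>(w)\<close> at each step of the sequence \<open>w, w\<^sup>p, w\<^sup>p\<^sup>p, \<dots>\<close>; as this sequence is
  periodic, the constant vanishes.
\<close>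
lemma char_sum_prime_power_invariant:
  assumes n: "n > 0" and p: "prime p" "odd p" "coprime p n"
    and rat: "\<And>i. char_sum n \<alpha> i \<in> \<rat>"
    and osc: "\<And>z w. z ^ n = 1 \<Longrightarrow> w ^ n = 1 \<Longrightarrow> \<bar>\<alpha> z - \<alpha> w\<bar> \<le> int K"
    and w: "w ^ n = 1"
  shows "\<alpha> (w ^ p) = \<alpha> w"
  using rat osc w
proof (induction K arbitrary: \<alpha> w rule: less_induct)
  case (less K)
  note rat = less.prems(1) and osc = less.prems(2) and w = less.prems(3)
  have p3: "int p \<ge> 3"
    using p prime_ge_2_nat[OF p(1)] by (cases "p = 2") auto
  define t where "t = totient n"
  have t: "t > 0" using n by (simp add: t_def)
  have pt: "w ^ (p ^ t) = w" if "w ^ n = 1" for w :: complex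
  proof -
    have "[p ^ t = 1] (mod n)"
      using euler_theorem[of p n] p(3) by (simp add: t_def)
    moreover have "p ^ t \<ge> 1"
      using prime_gt_0_nat[OF p(1)] by simp
    ultimately obtain m where "p ^ t = 1 + n * m"
      by (metis cong_le_nat cong_sym mult.commute add.commute)
    then show ?thesis
      by (simp add: power_add power_mult that)
  qed
  show ?case
  proof (cases "K = 0")
    case True
    then show ?thesis
      using osc[OF power_power_root_of_unity[OF w] w] by simp
  next
    case False
    define \<beta> where "\<beta> z = (\<alpha> (z ^ p) - \<alpha> z) div int p" for z
    have \<beta>: "\<alpha> (z ^ p) - \<alpha> z = int p * \<beta> z" if "z ^ n = 1" for z
      using char_sum_frobenius_congruence[OF n p(1,3) rat that] by (simp add: \<beta>_def)
    \<comment> \<open>The map \<open>z \<mapsto> z\<^sup>p\<close> has order dividing \<open>t\<close>, so its inverse is \<open>z \<mapsto> z ^ (p ^ (t - 1))\<close>.\<close>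
    have bij: "bij_betw (\<lambda>z. z ^ p) {z :: complex. z ^ n = 1} {z. z ^ n = 1}"
    proof (rule bij_betw_byWitness[where f' = "\<lambda>z. z ^ (p ^ (t - 1))"])
      have "p ^ t = p * p ^ (t - 1)" using t by (cases t) auto
      then have *: "z ^ (p * p ^ (t - 1)) = z" if "z ^ n = 1" for z :: complex
        using pt[OF that] by simp
      then show "\<forall>z\<in>{z :: complex. z ^ n = 1}. (z ^ p) ^ p ^ (t - 1) = z"
        by (simp flip: power_mult)
      from * show "\<forall>z\<in>{z :: complex. z ^ n = 1}. (z ^ p ^ (t - 1)) ^ p = z"
        by (simp add: mult.commute flip: power_mult)
    qed (auto intro: power_power_root_of_unity)
    have shift: "(\<Sum>z | z ^ n = 1. of_int (\<alpha> (z ^ p)) * z ^ i) = char_sum n \<alpha> (p ^ (t - 1) * i)" for i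
    proof -
      have "char_sum n \<alpha> (p ^ (t - 1) * i)
          = (\<Sum>z | z ^ n = 1. of_int (\<alpha> (z ^ p)) * (z ^ p) ^ (p ^ (t - 1) * i))"
        unfolding char_sum_def by (rule sum.reindex_bij_betw[OF bij, symmetric])
      also have "\<dots> = (\<Sum>z | z ^ n = 1. of_int (\<alpha> (z ^ p)) * z ^ i)"
      proof (intro sum.cong refl)
        fix z :: complex assume "z \<in> {z. z ^ n = 1}"
        have "(z ^ p) ^ (p ^ (t - 1) * i) = (z ^ (p * p ^ (t - 1))) ^ i"
          by (simp flip: power_mult add: mult.assoc)
        also have "p * p ^ (t - 1) = p ^ t" using t by (cases t) auto
        also have "z ^ p ^ t = z" using \<open>z \<in> _\<close> pt by simp
        finally show "of_int (\<alpha> (z ^ p)) * (z ^ p) ^ (p ^ (t - 1) * i) = of_int (\<alpha> (z ^ p)) * z ^ i"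
          by simp
      qed
      finally show ?thesis ..
    qed
    have rat\<beta>: "char_sum n \<beta> i \<in> \<rat>" for i
    proof -
      have "of_nat p * char_sum n \<beta> i = (\<Sum>z | z ^ n = 1. of_int (int p * \<beta> z) * z ^ i)"
        by (simp add: char_sum_def sum_distrib_left mult.assoc)
      also have "\<dots> = (\<Sum>z | z ^ n = 1. of_int (\<alpha> (z ^ p) - \<alpha> z) * z ^ i)"
        by (intro sum.cong refl) (simp flip: \<beta>)
      also have "\<dots> = char_sum n \<alpha> (p ^ (t - 1) * i) - char_sum n \<alpha> i"
        by (simp add: left_diff_distrib sum_subtractf shift) (simp add: char_sum_def)
      finally have "char_sum n \<beta> i = (char_sum n \<alpha> (p ^ (t - 1) * i) - char_sum n \<alpha> i) / of_nat p"
        using p3 by (simp add: field_simps)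
      then show ?thesis by (simp add: rat)
    qed
    have osc\<beta>: "\<bar>\<beta> z - \<beta> u\<bar> \<le> int (K - 1)" if "z ^ n = 1" "u ^ n = 1" for z u
    proof -
      have "int p * \<bar>\<beta> z - \<beta> u\<bar> = \<bar>(\<alpha> (z ^ p) - \<alpha> z) - (\<alpha> (u ^ p) - \<alpha> u)\<bar>"
        unfolding \<beta>[OF that(1)] \<beta>[OF that(2)] right_diff_distrib[symmetric] abs_mult by simp
      also have "\<dots> \<le> \<bar>\<alpha> (z ^ p) - \<alpha> (u ^ p)\<bar> + \<bar>\<alpha> z - \<alpha> u\<bar>"
        by linarith
      also have "\<dots> \<le> 2 * int K"
        using osc[OF that]
          osc[OF power_power_root_of_unity[OF that(1), of p] power_power_root_of_unity[OF that(2), of p]]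
        by linarith
      finally have "int p * \<bar>\<beta> z - \<beta> u\<bar> \<le> 2 * int K" .
      moreover have "3 * \<bar>\<beta> z - \<beta> u\<bar> \<le> int p * \<bar>\<beta> z - \<beta> u\<bar>"
        using p3 by (intro mult_right_mono) auto
      ultimately have "3 * \<bar>\<beta> z - \<beta> u\<bar> \<le> 2 * int K"
        by (rule order_trans[rotated])
      moreover have "x \<le> k - 1" if "3 * x \<le> 2 * k" "k \<ge> 1" for x k :: int
        using that by presburger
      ultimately have "\<bar>\<beta> z - \<beta> u\<bar> \<le> int K - 1"
        using False by simp
      then show ?thesis using False by (simp add: of_nat_diff)
    qed
    have inv\<beta>: "\<beta> (z ^ p) = \<beta> z" if "z ^ n = 1" for z
      using less.IH[of "K - 1" \<beta> z] rat\<beta> osc\<beta> that False by simp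
    have "\<alpha> (w ^ (p ^ s)) = \<alpha> w + int s * (int p * \<beta> w) \<and> \<beta> (w ^ (p ^ s)) = \<beta> w" for s
    proof (induction s)
      case (Suc s)
      let ?u = "w ^ (p ^ s)"
      have u: "?u ^ n = 1" using w by (rule power_power_root_of_unity)
      have "w ^ (p ^ Suc s) = ?u ^ p" by (simp flip: power_mult add: mult.commute)
      then show ?case using Suc \<beta>[OF u] inv\<beta>[OF u] by (simp add: algebra_simps)
    qed simp
    from this[of t] have "\<beta> w = 0"
      using pt[OF w] t p3 by auto
    then show ?thesis using \<beta>[OF w] by simp
  qed
qed

text \<open>
  The case of an odd exponent follows from its prime factorization. An even exponent \<open>u\<close> coprime to \<open>n\<close>
  forces \<open>n\<close> to be odd, and then \<open>u + n\<close> is an odd exponent with the same effect.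
\<close>
lemma char_sum_coprime_power_invariant:
  assumes n: "n > 0" and rat: "\<And>i. char_sum n \<alpha> i \<in> \<rat>"
    and u: "coprime u n" and w: "w ^ n = 1"
  shows "\<alpha> (w ^ u) = \<alpha> w"
proof -
  have fin: "finite {z :: complex. z ^ n = 1}" using finite_roots_unity[of n] n by simp
  define K where "K = nat (2 * (\<Sum>z | z ^ n = 1. \<bar>\<alpha> z\<bar>))"
  have osc: "\<bar>\<alpha> z - \<alpha> z'\<bar> \<le> int K" if "z ^ n = 1" "z' ^ n = 1" for z z'
  proof -
    have "\<bar>\<alpha> z\<bar> \<le> (\<Sum>z | z ^ n = 1. \<bar>\<alpha> z\<bar>)" "\<bar>\<alpha> z'\<bar> \<le> (\<Sum>z | z ^ n = 1. \<bar>\<alpha> z\<bar>)"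
      using that by (auto intro!: member_le_sum fin)
    then show ?thesis by (simp add: K_def)
  qed
  have odd: "\<alpha> (w ^ u) = \<alpha> w" if "odd u" "coprime u n" "w ^ n = 1" for u w
    using that
  proof (induction u arbitrary: w rule: less_induct)
    case (less u)
    show ?case
    proof (cases "u = 1")
      case False
      then obtain p where p: "prime p" "p dvd u" using prime_factor_nat by blast
      then obtain s where s: "u = p * s" by (elim dvdE)
      have s': "odd s" "coprime s n" "odd p" "coprime p n" using less.prems s by auto
      have "s > 0" using s' by (auto intro: Nat.gr0I)
      then have "s < u" using s prime_gt_1_nat[OF p(1)] by simp
      have "\<alpha> (w ^ u) = \<alpha> ((w ^ s) ^ p)" by (simp add: s mult.commute flip: power_mult)
      also have "\<dots> = \<alpha> (w ^ s)"
        by (rule char_sum_prime_power_invariant[OF n p(1) s'(3,4) rat osc])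
          (use less.prems(3) in \<open>auto intro: power_power_root_of_unity\<close>)
      also have "\<dots> = \<alpha> w" using less.IH[OF \<open>s < u\<close> s'(1,2) less.prems(3)] .
      finally show ?thesis .
    qed simp
  qed
  show ?thesis
  proof (cases "odd u")
    case False
    then have "odd n" using u by auto
    moreover have "coprime (u + n) n"
      using u by (metis coprime_iff_gcd_eq_1 gcd_add1 gcd.commute)
    ultimately have "\<alpha> (w ^ (u + n)) = \<alpha> w"
      using False w by (intro odd) auto
    then show ?thesis by (simp add: power_add w)
  qed (use odd u w in auto)
qed

definition primitive_roots :: "nat \<Rightarrow> complex set" where
  "primitive_roots d = {z. \<forall>j. z ^ j = 1 \<longleftrightarrow> d dvd j}"

lemma primitive_rootsD: "z \<in> primitive_roots d \<Longrightarrow> z ^ j = 1 \<longleftrightarrow> d dvd j"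
  unfolding primitive_roots_def by blast

lemma cis_in_primitive_roots: "d > 0 \<Longrightarrow> cis (2 * pi / real d) \<in> primitive_roots d"
  by (simp add: primitive_roots_def cis_power_eq_1_iff)

lemma roots_of_unity_partition:
  assumes "n > 0"
  shows "{z :: complex. z ^ n = 1} = (\<Union>d\<in>{d. d dvd n}. primitive_roots d)"
proof (intro equalityI subsetI)
  fix z :: complex assume z: "z \<in> {z. z ^ n = 1}"
  define d where "d = (LEAST e. 0 < e \<and> z ^ e = 1)"
  have d: "0 < d \<and> z ^ d = 1"
    unfolding d_def by (rule LeastI[of _ n]) (use z assms in auto)
  have min: "d \<le> e" if "0 < e" "z ^ e = 1" for e
    unfolding d_def by (rule Least_le) (use that in auto)
  have "z ^ j = 1 \<longleftrightarrow> d dvd j" for j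
  proof
    assume "z ^ j = 1"
    moreover have "z ^ j = z ^ (d * (j div d) + j mod d)" by simp
    ultimately have "z ^ (j mod d) = 1"
      by (simp only: power_add power_mult d power_one mult_1)
    moreover have "j mod d < d" using d by simp
    ultimately have "j mod d = 0"
      using min[of "j mod d"] by (meson leD neq0_conv)
    then show "d dvd j" by (simp add: mod_eq_0_iff_dvd)
  next
    assume "d dvd j"
    then show "z ^ j = 1" using d by (auto simp: power_mult elim!: dvdE)
  qed
  then show "z \<in> (\<Union>d\<in>{d. d dvd n}. primitive_roots d)"
    using z by (auto simp: primitive_roots_def)
qed (auto simp: primitive_roots_def)

lemma primitive_roots_disjoint:
  assumes "d \<noteq> e"
  shows "primitive_roots d \<inter> primitive_roots e = {}"
proof -
  have False if "z \<in> primitive_roots d" "z \<in> primitive_roots e" for z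
  proof -
    have eq: "d dvd j \<longleftrightarrow> e dvd j" for j
      using that unfolding primitive_roots_def by blast
    have "d dvd e" "e dvd d" using eq[of e] eq[of d] by simp_all
    then show False using assms dvd_antisym by blast
  qed
  then show ?thesis by blast
qed

lemma finite_primitive_roots:
  assumes "d > 0"
  shows "finite (primitive_roots d)"
proof (rule finite_subset)
  show "primitive_roots d \<subseteq> {z. z ^ d = 1}"
    by (simp add: subset_iff primitive_rootsD)
  show "finite {z :: complex. z ^ d = 1}"
    using finite_roots_unity[of d] assms by simp
qed

lemma sum_roots_of_unity_by_order:
  fixes g :: "complex \<Rightarrow> complex"
  assumes "n > 0"
  shows "(\<Sum>z | z ^ n = 1. g z) = (\<Sum>d | d dvd n. \<Sum>z\<in>primitive_roots d. g z)"
proof -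
  have "d > 0" if "d dvd n" for d using that assms by (auto intro: Nat.gr0I)
  then show ?thesis
    unfolding roots_of_unity_partition[OF assms]
    by (intro sum.UNION_disjoint) (use assms in \<open>auto simp: finite_primitive_roots primitive_roots_disjoint\<close>)
qed

text \<open>
  The squarefree divisors of \<open>n\<close> are the products of sets \<open>T\<close> of prime factors of \<open>n\<close>, and the sum of
  \<open>(-1)\<close> to the power \<open>|T|\<close> over all such \<open>T\<close> is the expansion of a product of factors \<open>1 - 1\<close>, one for each prime.
\<close>
lemma sum_moebius_divisors:
  assumes n: "n > 0"
  shows "(\<Sum>d | d dvd n. moebius d) = (if n = 1 then 1 else 0)"
proof -
  have prime: "prime p" if "p \<in> prime_factors n" for p using that by auto
  have pf: "prime_factors (\<Prod>T) = T" if "T \<subseteq> prime_factors n" for T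
  proof -
    have "finite T" using that finite_subset by blast
    moreover have "0 \<notin> T" using that by auto
    ultimately have "prime_factors (\<Prod>T) = (\<Union>p\<in>T. prime_factors p)"
      using prime_factors_prod[of T "\<lambda>x. x"] by auto
    also have "\<dots> = (\<Union>p\<in>T. {p})"
      using that prime by (intro SUP_cong refl) (auto simp: prime_factorization_prime)
    finally show ?thesis by simp
  qed
  have sqf: "squarefree (\<Prod>T)" if "T \<subseteq> prime_factors n" for T
    by (rule squarefree_prod_coprime) (use that prime in \<open>auto intro: primes_coprime squarefree_prime\<close>)
  have rad: "\<Prod>(prime_factors d) = d" if "squarefree d" for d :: nat
  proof -
    have d0: "d \<noteq> 0" using that by (metis not_squarefree_0)
    have "d = (\<Prod>p\<in>prime_factors d. p ^ multiplicity p d)"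
      using d0 by (simp add: prime_factorization_nat)
    also have "\<dots> = (\<Prod>p\<in>prime_factors d. p)"
    proof (intro prod.cong refl)
      fix p assume p: "p \<in> prime_factors d"
      then have "multiplicity p d \<le> 1"
        using that d0 by (auto simp: squarefree_factorial_semiring'')
      moreover have "multiplicity p d > 0"
        using p by (simp add: prime_factors_multiplicity)
      ultimately have "multiplicity p d = 1" by simp
      then show "p ^ multiplicity p d = p" by simp
    qed
    finally show ?thesis by simp
  qed
  have "(\<Sum>d | d dvd n. moebius d) = (\<Sum>d | d dvd n \<and> squarefree d. (- 1) ^ card (prime_factors d))"
    by (rule sum.mono_neutral_cong_right) (use n in \<open>auto simp: moebius_def\<close>)
  also have "\<dots> = (\<Sum>T\<in>Pow (prime_factors n). (- 1) ^ card T)"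
  proof (rule sum.reindex_bij_witness[of _ "\<lambda>T. \<Prod>T" prime_factors])
    fix d assume d: "d \<in> {d. d dvd n \<and> squarefree d}"
    then show "\<Prod>(prime_factors d) = d" using rad by simp
    show "prime_factors d \<in> Pow (prime_factors n)"
      using d n dvd_prime_factors[of n d] by auto
  next
    fix T assume T: "T \<in> Pow (prime_factors n)"
    then show "prime_factors (\<Prod>T) = T" using pf by simp
    have "\<Prod>T dvd n"
    proof -
      have "\<Prod>T dvd \<Prod>(prime_factors n)"
        using T by (intro prod_dvd_prod_subset) auto
      also have "\<dots> dvd (\<Prod>p\<in>prime_factors n. p ^ multiplicity p n)"
        by (intro prod_dvd_prod) (auto simp: prime_factors_multiplicity intro!: dvd_power)
      also have "\<dots> = n" using n by (simp flip: prime_factorization_nat)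
      finally show ?thesis .
    qed
    then show "\<Prod>T \<in> {d. d dvd n \<and> squarefree d}" using sqf T by simp
  qed simp
  also have "\<dots> = (\<Prod>p\<in>prime_factors n. (1 - 1 :: int))"
    by (subst prod_diff_conv_sum) auto
  also have "\<dots> = (if n = 1 then 1 else 0)"
    using n by (auto simp: power_0_left prime_factorization_empty_iff)
  finally show ?thesis .
qed

text \<open>
  Both sides have the same sum over the divisors of any positive number: the sum of all \<open>n\<close>-th roots of
  unity is \<open>1\<close> for \<open>n = 1\<close> and \<open>0\<close> otherwise.
\<close>
lemma sum_primitive_roots:
  assumes "d > 0"
  shows "\<Sum>(primitive_roots d) = of_int (moebius d)"
  using assms
proof (induction d rule: less_induct)
  case (less d)
  have fin: "finite {e. e dvd d}" using less.prems by simp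
  have set: "{e. e dvd d} = insert d {e. e dvd d \<and> e \<noteq> d}" by auto
  have "(\<Sum>e | e dvd d. \<Sum>(primitive_roots e)) = (\<Sum>z | z ^ d = 1. z)"
    using sum_roots_of_unity_by_order[OF less.prems, of "\<lambda>z. z"] by simp
  also have "\<dots> = (if d = 1 then 1 else 0)"
    using less.prems sum_roots_unity[of d] by (cases "d = 1") auto
  also have "\<dots> = of_int (\<Sum>e | e dvd d. moebius e)"
    by (simp add: sum_moebius_divisors[OF less.prems])
  finally have eq: "(\<Sum>e | e dvd d. \<Sum>(primitive_roots e)) = (\<Sum>e | e dvd d. of_int (moebius e))"
    by simp
  have "\<Sum>(primitive_roots e) = of_int (moebius e)" if "e dvd d" "e \<noteq> d" for e
    by (rule less.IH) (use that less.prems in \<open>auto intro: Nat.gr0I simp: dvd_imp_le order_le_less\<close>)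
  then have "(\<Sum>e | e dvd d \<and> e \<noteq> d. \<Sum>(primitive_roots e)) = (\<Sum>e | e dvd d \<and> e \<noteq> d. of_int (moebius e))"
    by (intro sum.cong refl) auto
  with eq show ?case
    using fin unfolding set by (subst (asm) (1 2) sum.insert) auto
qed

text \<open>
  For a divisor \<open>d\<close> of \<open>n\<close> this says that units modulo \<open>d\<close> lift to units modulo \<open>n\<close>. The product \<open>t\<close> of
  the primes dividing \<open>n\<close> but not \<open>k\<close> is chosen so that every prime factor of \<open>n\<close> divides exactly one
  of \<open>k\<close> and \<open>d t\<close>.
\<close>
lemma coprime_lift:
  fixes k d n :: nat
  assumes "n > 0" "coprime k d"
  shows "\<exists>u. coprime u n \<and> [u = k] (mod d)"
proof -
  define t where "t = \<Prod>{q \<in> prime_factors n. \<not> q dvd k}"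
  have "coprime (k + d * t) n"
  proof (rule ccontr)
    assume "\<not> coprime (k + d * t) n"
    then obtain q where q: "prime q" "q dvd k + d * t" "q dvd n"
      using prime_factor_nat[of "gcd (k + d * t) n"] by (auto simp: coprime_iff_gcd_eq_1)
    show False
    proof (cases "q dvd k")
      case True
      then have "q dvd d * t" using q(2) by (simp add: dvd_add_right_iff)
      moreover have "\<not> q dvd d"
        using True q(1) assms(2) coprime_common_divisor not_prime_unit by blast
      ultimately have "q dvd t" using q(1) by (simp add: prime_dvd_mult_iff)
      then obtain r where "r \<in> prime_factors n" "\<not> r dvd k" "q dvd r"
        unfolding t_def using q(1) by (auto simp: prime_dvd_prod_iff)
      then have "r = q"
        using q(1) by (metis in_prime_factors_imp_prime primes_dvd_imp_eq)
      then show False using True \<open>\<not> r dvd k\<close> by simp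
    next
      case False
      then have "q dvd t" unfolding t_def
        using q assms(1) by (intro dvd_prodI[of _ q "\<lambda>x. x", simplified]) (auto simp: in_prime_factors_iff)
      then have "q dvd k" using q(2) by (meson dvd_add_left_iff dvd_mult)
      with False show False ..
    qed
  qed
  then show ?thesis
    by (intro exI[of _ "k + d * t"]) (auto simp: cong_def)
qed

text \<open>
  Any two primitive \<open>d\<close>-th roots of unity are powers of each other with an exponent coprime to \<open>d\<close>, and that
  exponent may be taken coprime to \<open>n\<close>.
\<close>
lemma char_sum_rational_imp_const_on_order:
  assumes n: "n > 0" and d: "d dvd n" and rat: "\<And>i. char_sum n \<alpha> i \<in> \<rat>"
    and z: "z \<in> primitive_roots d"
  shows "\<alpha> z = \<alpha> (cis (2 * pi / real d))"
proof -
  have d0: "d > 0" using n d by (auto intro: Nat.gr0I)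
  let ?\<zeta> = "cis (2 * pi / real d)"
  have \<zeta>d: "?\<zeta> ^ d = 1" using d0 by (simp add: cis_power_eq_1_iff)
  have "z \<in> (\<lambda>k. ?\<zeta> ^ k) ` {..<d}"
    using z unfolding roots_of_unity_eq_powers[OF d0, symmetric] by (simp add: primitive_rootsD)
  then obtain k where k: "z = ?\<zeta> ^ k" by auto
  have "coprime k d"
  proof -
    define g where "g = gcd k d"
    obtain k' d' where kd: "k = g * k'" "d = g * d'"
      unfolding g_def by (metis gcd_dvd1 gcd_dvd2 dvdE)
    have "d' > 0" using kd d0 by (auto intro: Nat.gr0I)
    have "z ^ d' = (?\<zeta> ^ d) ^ k'"
      unfolding k by (simp flip: power_mult add: kd mult_ac)
    then have "d dvd d'" using \<zeta>d by (simp flip: primitive_rootsD[OF z])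
    then have "gcd k d = 1"
      using \<open>d' > 0\<close> kd(2) unfolding g_def[symmetric] by simp
    then show ?thesis by (simp add: coprime_iff_gcd_eq_1)
  qed
  then obtain u where u: "coprime u n" "[u = k] (mod d)" using coprime_lift[OF n] by blast
  have mod: "?\<zeta> ^ j = ?\<zeta> ^ (j mod d)" for j
  proof -
    have "?\<zeta> ^ j = ?\<zeta> ^ (d * (j div d) + j mod d)" by simp
    then show ?thesis by (simp only: power_add power_mult \<zeta>d power_one mult_1)
  qed
  have "z = ?\<zeta> ^ u" using mod[of u] mod[of k] u(2) k by (simp add: cong_def)
  moreover have "?\<zeta> ^ n = 1" using d d0 by (simp add: cis_power_eq_1_iff)
  ultimately show ?thesis
    using char_sum_coprime_power_invariant[OF n rat u(1)] by metis
qed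

lemma char_sum_1_eq_moebius_sum:
  assumes n: "n > 0" and rat: "\<And>i. char_sum n \<alpha> i \<in> \<rat>"
  shows "char_sum n \<alpha> 1 = of_int (\<Sum>d | d dvd n. \<alpha> (cis (2 * pi / real d)) * moebius d)"
proof -
  have "char_sum n \<alpha> 1 = (\<Sum>d | d dvd n. \<Sum>z\<in>primitive_roots d. of_int (\<alpha> z) * z)"
    by (simp add: char_sum_def sum_roots_of_unity_by_order[OF n])
  also have "\<dots> = (\<Sum>d | d dvd n. \<Sum>z\<in>primitive_roots d. of_int (\<alpha> (cis (2 * pi / real d))) * z)"
    by (intro sum.cong refl) (use char_sum_rational_imp_const_on_order[OF n _ rat] in auto)
  also have "\<dots> = (\<Sum>d | d dvd n. of_int (\<alpha> (cis (2 * pi / real d)) * moebius d))"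
  proof (intro sum.cong refl)
    fix d assume "d \<in> {d. d dvd n}"
    then have "d > 0" using n by (auto intro: Nat.gr0I)
    then show "(\<Sum>z\<in>primitive_roots d. of_int (\<alpha> (cis (2 * pi / real d))) * z)
        = of_int (\<alpha> (cis (2 * pi / real d)) * moebius d)"
      using sum_primitive_roots[of d] by (simp flip: sum_distrib_left)
  qed
  finally show ?thesis by simp
qed

section \<open>Eigenvalue multiplicities of a permutation\<close>

lemma funpow_fixed_iff_card_orbit_dvd:
  assumes "permutation \<phi>"
  shows "(\<phi> ^^ i) x = x \<longleftrightarrow> card (orbit \<phi> x) dvd i"
proof -
  have self: "x \<in> orbit \<phi> x" using assms by (rule permutation_self_in_orbit)
  define l where "l = funpow_dist1 \<phi> x x"
  have l: "(\<phi> ^^ l) x = x" "l > 0"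
    unfolding l_def using funpow_dist1_prop[OF self] by auto
  have card: "card (orbit \<phi> x) = l"
    unfolding l_def orbit_conv_funpow_dist1[OF self]
    by (subst card_image[OF inj_on_funpow_dist1[OF self]]) simp
  have "(\<phi> ^^ i) x = (\<phi> ^^ (i mod l)) x" by (rule funpow_mod_eq[OF l(1), symmetric])
  also have "\<dots> = x \<longleftrightarrow> i mod l = 0"
    using funpow_neq_less_funpow_dist1[OF self, of "i mod l" 0] l(2) mod_less_divisor[OF l(2), of i]
    unfolding l_def[symmetric] by (metis funpow_0)
  finally show ?thesis by (simp add: card mod_eq_0_iff_dvd)
qed

lemma sum_by_orbits:
  fixes g :: "nat \<Rightarrow> 'b :: comm_semiring_1"
  assumes "finite V" "\<phi> permutes V"
  shows "(\<Sum>x\<in>V. g (card (orbit \<phi> x))) = (\<Sum>C\<in>orbit \<phi> ` V. of_nat (card C) * g (card C))"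
proof -
  have perm: "permutation \<phi>" using assms by (auto simp: permutation_permutes)
  have fiber: "{x \<in> V. orbit \<phi> x = C} = C" if "C \<in> orbit \<phi> ` V" for C
  proof -
    from that obtain y where y: "y \<in> V" "C = orbit \<phi> y" by auto
    have "orbit \<phi> y \<subseteq> V" using assms(2) y(1) by (rule permutes_orbit_subset)
    moreover have "orbit \<phi> x = orbit \<phi> y" if "x \<in> orbit \<phi> y" for x
      using cyclic_on_orbit'[OF perm, of y] that by (rule orbit_cyclic_eq3)
    moreover have "x \<in> orbit \<phi> x" for x using perm by (rule permutation_self_in_orbit)
    ultimately show ?thesis unfolding y(2) by blast
  qed
  have "(\<Sum>x\<in>V. g (card (orbit \<phi> x)))
      = (\<Sum>C\<in>orbit \<phi> ` V. \<Sum>x\<in>{x \<in> V. orbit \<phi> x = C}. g (card (orbit \<phi> x)))"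
    using assms(1) by (rule sum.image_gen)
  also have "\<dots> = (\<Sum>C\<in>orbit \<phi> ` V. \<Sum>x\<in>{x \<in> V. orbit \<phi> x = C}. g (card C))"
    by (intro sum.cong refl) auto
  also have "\<dots> = (\<Sum>C\<in>orbit \<phi> ` V. of_nat (card C) * g (card C))"
    by (intro sum.cong refl) (simp add: fiber)
  finally show ?thesis .
qed

lemma sum_powers_multiples:
  fixes y :: complex
  assumes n: "n > 0" and l: "l dvd n" and y: "y ^ n = 1"
  shows "(\<Sum>i | i < n \<and> l dvd i. y ^ i) = (if y ^ l = 1 then of_nat (n div l) else 0)"
proof -
  from l obtain q where q: "n = l * q" by (elim dvdE)
  have l0: "l > 0" using n q by (auto intro: Nat.gr0I)
  have "{i. i < n \<and> l dvd i} = (\<lambda>t. l * t) ` {..<q}"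
    using l0 by (auto simp: q elim!: dvdE)
  then have "(\<Sum>i | i < n \<and> l dvd i. y ^ i) = (\<Sum>t<q. (y ^ l) ^ t)"
    using l0 by (simp add: sum.reindex inj_on_def power_mult)
  also have "\<dots> = (if y ^ l = 1 then of_nat q else 0)"
    using y by (intro sum_powers_root_of_unity) (simp add: q power_mult)
  finally show ?thesis using l0 by (simp add: q)
qed

text \<open>
  The number of fixed points of \<open>\<phi>\<^sup>i\<close> is the character of the permutation representation, so this is
  the inversion formula for the multiplicity of \<open>w\<close>. A point on a cycle of length \<open>l\<close> is fixed exactly by the
  powers \<open>\<phi>\<^sup>i\<close> with \<open>l\<close> dividing \<open>i\<close>, and contributes a geometric sum equal to \<open>n / l\<close> if \<open>w\<^sup>l = 1\<close> and
  to \<open>0\<close> otherwise; the \<open>l\<close> points of the cycle together contribute \<open>n\<close> or \<open>0\<close>.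
\<close>
lemma fixed_points_inversion:
  assumes V: "finite V" "\<phi> permutes V" and n: "n > 0" "\<phi> ^^ n = id"
    and d: "d dvd n" and w: "w \<in> primitive_roots d"
  shows "(\<Sum>i<n. of_nat (card {x \<in> V. (\<phi> ^^ i) x = x}) * inverse w ^ i)
    = of_nat n * of_nat (card {C \<in> orbit \<phi> ` V. d dvd card C})"
proof -
  have perm: "permutation \<phi>" using V by (auto simp: permutation_permutes)
  note fixed = funpow_fixed_iff_card_orbit_dvd[OF perm]
  have card_dvd: "card (orbit \<phi> x) dvd n" for x
    using fixed[of n x] n(2) by simp
  have wn: "inverse w ^ n = 1"
    using d primitive_rootsD[OF w, of n] by (simp add: power_inverse)
  have wl: "inverse w ^ l = 1 \<longleftrightarrow> d dvd l" for l
    using primitive_rootsD[OF w, of l] by (simp add: power_inverse)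
  have "(\<Sum>i<n. of_nat (card {x \<in> V. (\<phi> ^^ i) x = x}) * inverse w ^ i)
      = (\<Sum>i<n. \<Sum>x\<in>V. if card (orbit \<phi> x) dvd i then inverse w ^ i else 0)"
    using V(1) by (simp add: fixed sum.If_cases Int_def)
  also have "\<dots> = (\<Sum>x\<in>V. \<Sum>i<n. if card (orbit \<phi> x) dvd i then inverse w ^ i else 0)"
    by (rule sum.swap)
  also have "\<dots> = (\<Sum>x\<in>V. \<Sum>i | i < n \<and> card (orbit \<phi> x) dvd i. inverse w ^ i)"
    by (rule sum.cong[OF refl]) (simp add: sum.If_cases Int_def)
  also have "\<dots> = (\<Sum>x\<in>V. if d dvd card (orbit \<phi> x) then of_nat (n div card (orbit \<phi> x)) else 0)"
    by (intro sum.cong refl, subst sum_powers_multiples[OF n(1) card_dvd wn]) (simp only: wl)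
  also have "\<dots> = (\<Sum>C\<in>orbit \<phi> ` V. of_nat (card C) * (if d dvd card C then of_nat (n div card C) else 0))"
    by (rule sum_by_orbits[OF V])
  also have "\<dots> = (\<Sum>C\<in>orbit \<phi> ` V. if d dvd card C then of_nat n else 0)"
  proof (intro sum.cong refl)
    fix C assume "C \<in> orbit \<phi> ` V"
    then have "card C * (n div card C) = n" using card_dvd by auto
    then have "of_nat (card C) * of_nat (n div card C) = (of_nat n :: complex)"
      by (metis of_nat_mult)
    then show "of_nat (card C) * (if d dvd card C then of_nat (n div card C) else 0)
        = (if d dvd card C then of_nat n else 0 :: complex)"
      by simp
  qed
  also have "\<dots> = of_nat n * of_nat (card {C \<in> orbit \<phi> ` V. d dvd card C})"
    using V(1) by (simp add: sum.If_cases Int_def mult.commute)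
  finally show ?thesis .
qed

section \<open>Eigenvalue multiplicities on an invariant subspace\<close>

definition mat_trace :: "'a :: comm_ring_1 mat \<Rightarrow> 'a" where
  "mat_trace M = (\<Sum>i<dim_row M. M $$ (i, i))"

lemma mat_trace_mult_comm:
  assumes A: "A \<in> carrier_mat n m" and B: "B \<in> carrier_mat m n"
  shows "mat_trace (A * B) = mat_trace (B * A)"
proof -
  have "mat_trace (A * B) = (\<Sum>i<n. \<Sum>j<m. A $$ (i, j) * B $$ (j, i))"
    using A B by (simp add: mat_trace_def scalar_prod_def atLeast0LessThan)
  also have "\<dots> = (\<Sum>j<m. \<Sum>i<n. B $$ (j, i) * A $$ (i, j))"
    by (subst sum.swap) (simp add: mult.commute)
  also have "\<dots> = mat_trace (B * A)"
    using A B by (simp add: mat_trace_def scalar_prod_def atLeast0LessThan)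
  finally show ?thesis .
qed

lemma upper_triangular_power:
  fixes B :: "'a :: comm_ring_1 mat"
  assumes B: "B \<in> carrier_mat n n" "upper_triangular B"
  shows "upper_triangular (B ^\<^sub>m i) \<and> (\<forall>j<n. (B ^\<^sub>m i) $$ (j, j) = (B $$ (j, j)) ^ i)"
proof (induction i)
  case 0
  show ?case using B by auto
next
  case (Suc i)
  let ?X = "B ^\<^sub>m i"
  have X: "?X \<in> carrier_mat n n" using B by simp
  have entry: "(?X * B) $$ (a, b) = (\<Sum>c<n. ?X $$ (a, c) * B $$ (c, b))" if "a < n" "b < n" for a b
    using that X B by (simp add: scalar_prod_def atLeast0LessThan)
  have low: "?X $$ (a, c) * B $$ (c, b) = 0" if "a < n" "c < n" "b < n" "b \<le> a" "c \<noteq> a \<or> c \<noteq> b" for a b c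
  proof (cases "c < a")
    case True
    then have "?X $$ (a, c) = 0" using Suc.IH X that by (auto dest: upper_triangularD)
    then show ?thesis by simp
  next
    case False
    then have "b < c" using that by linarith
    then have "B $$ (c, b) = 0" using B that by (auto dest: upper_triangularD)
    then show ?thesis by simp
  qed
  show ?case
  proof (intro conjI allI impI)
    show "upper_triangular (B ^\<^sub>m Suc i)"
    proof (rule upper_triangularI)
      fix a b assume "b < a" "a < dim_row (B ^\<^sub>m Suc i)"
      then have ab: "b < a" "a < n" using B by auto
      then have "(?X * B) $$ (a, b) = 0"
        by (subst entry) (auto intro!: sum.neutral low)
      then show "(B ^\<^sub>m Suc i) $$ (a, b) = 0" by simp
    qed
    fix j assume j: "j < n"
    have "(\<Sum>c<n. ?X $$ (j, c) * B $$ (c, j)) = (\<Sum>c<n. if c = j then ?X $$ (j, j) * B $$ (j, j) else 0)"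
      using j low by (intro sum.cong refl) auto
    then show "(B ^\<^sub>m Suc i) $$ (j, j) = (B $$ (j, j)) ^ Suc i"
      using j Suc.IH by (simp add: entry mult.commute del: index_mult_mat)
  qed
qed

text \<open>
  The list consists of the eigenvalues of \<open>A\<close> with algebraic multiplicity, found on the diagonal of a
  triangular matrix similar to \<open>A\<close>.
\<close>
lemma mat_trace_powers:
  fixes A :: "complex mat"
  assumes A: "A \<in> carrier_mat N N" and per: "A ^\<^sub>m Suc n = A"
  shows "\<exists>es. (\<forall>i. mat_trace (A ^\<^sub>m i) = (\<Sum>e\<leftarrow>es. e ^ i)) \<and> (\<forall>e\<in>set es. e ^ Suc n = e)"
proof -
  obtain es where "char_poly A = (\<Prod>e\<leftarrow>es. [:- e, 1:])"
    using char_poly_factorized[OF A] by blast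
  moreover obtain B P Q where "schur_decomposition A es = (B, P, Q)"
    by (metis prod_cases3)
  ultimately have sim: "similar_mat_wit A B P Q" and ut: "upper_triangular B" and diag: "diag_mat B = es"
    using schur_decomposition[OF A] by blast+
  note wit = similar_mat_witD2[OF A sim]
  have B: "B \<in> carrier_mat N N" and P: "P \<in> carrier_mat N N" and Q: "Q \<in> carrier_mat N N"
    and QP: "Q * P = 1\<^sub>m N"
    using wit by auto
  have es: "es = map (\<lambda>j. B $$ (j, j)) [0..<N]"
    using diag B by (simp add: diag_mat_def)
  have "mat_trace (A ^\<^sub>m i) = (\<Sum>e\<leftarrow>es. e ^ i)" for i
  proof -
    have Bi: "B ^\<^sub>m i \<in> carrier_mat N N" using B by simp
    have "mat_trace (A ^\<^sub>m i) = mat_trace ((P * B ^\<^sub>m i) * Q)"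
      by (simp add: similar_mat_wit_pow_id[OF sim])
    also have "\<dots> = mat_trace (Q * (P * B ^\<^sub>m i))"
      using P Q Bi by (intro mat_trace_mult_comm[of _ N N]) auto
    also have "Q * (P * B ^\<^sub>m i) = (Q * P) * B ^\<^sub>m i"
      using P Q Bi by (intro assoc_mult_mat[symmetric]) auto
    also have "\<dots> = B ^\<^sub>m i" unfolding QP using Bi by (rule left_mult_one_mat)
    also have "mat_trace (B ^\<^sub>m i) = (\<Sum>j<N. (B $$ (j, j)) ^ i)"
      using B upper_triangular_power[OF B ut, of i] by (simp add: mat_trace_def)
    also have "\<dots> = (\<Sum>e\<leftarrow>es. e ^ i)"
      by (simp add: es o_def interv_sum_list_conv_sum_set_nat atLeast0LessThan)
    finally show ?thesis .
  qed
  moreover have "e ^ Suc n = e" if "e \<in> set es" for e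
  proof -
    from that obtain j where j: "j < N" "e = B $$ (j, j)" by (auto simp: es)
    have sim': "similar_mat_wit B A Q P" using sim by (rule similar_mat_wit_sym)
    have "B ^\<^sub>m Suc n = Q * A ^\<^sub>m Suc n * P" using similar_mat_wit_pow_id[OF sim'] .
    also have "\<dots> = B"
      unfolding per using similar_mat_wit_pow_id[OF sim', of 1] B A by simp
    finally show ?thesis
      using upper_triangular_power[OF B ut, of "Suc n"] j by metis
  qed
  ultimately show ?thesis by blast
qed

lemma sum_list_eq_sum_count_list:
  fixes f :: "'a \<Rightarrow> 'b :: comm_semiring_1"
  assumes "finite S" "set xs \<subseteq> S"
  shows "(\<Sum>x\<in>S. of_nat (count_list xs x) * f x) = (\<Sum>x\<leftarrow>xs. f x)"
  using assms(2)
proof (induction xs)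
  case (Cons a xs)
  have "(\<Sum>x\<in>S. of_nat (count_list (a # xs) x) * f x)
      = (\<Sum>x\<in>S. (if x = a then f a else 0) + of_nat (count_list xs x) * f x)"
    by (intro sum.cong refl) (auto simp: algebra_simps)
  also have "\<dots> = f a + (\<Sum>x\<in>S. of_nat (count_list xs x) * f x)"
    using assms(1) Cons.prems by (simp add: sum.distrib)
  finally show ?case using Cons by simp
qed simp

text \<open>
  The kernel \<open>E\<close> is the matrix of a projection commuting with \<open>\<phi>\<close>, and \<open>M\<close> below is the product of
  the permutation matrix and \<open>E\<close>, so that the entries of \<open>M\<^sup>i\<close> are \<open>E (\<phi>\<^sup>i x) y\<close> for positive \<open>i\<close>. From
  \<open>M\<^sup>n\<^sup>+\<^sup>1 = M\<close> the eigenvalues of \<open>M\<close> are \<open>0\<close> or \<open>n\<close>-th roots of unity; the latter are the eigenvalues of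
  \<open>\<phi>\<close> on the image of \<open>E\<close>, and the former do not contribute to the traces.
\<close>
lemma invariant_idempotent_multiplicities:
  fixes E :: "'a \<Rightarrow> 'a \<Rightarrow> complex"
  assumes V: "finite V" "\<phi> permutes V" and n: "n > 0" "\<phi> ^^ n = id"
    and inv: "\<And>x y. x \<in> V \<Longrightarrow> y \<in> V \<Longrightarrow> E (\<phi> x) (\<phi> y) = E x y"
    and idem: "\<And>x y. x \<in> V \<Longrightarrow> y \<in> V \<Longrightarrow> (\<Sum>z\<in>V. E x z * E z y) = E x y"
  shows "\<exists>\<alpha> :: complex \<Rightarrow> nat. \<forall>i. (\<Sum>x\<in>V. E ((\<phi> ^^ i) x) x) = char_sum n (\<lambda>z. int (\<alpha> z)) i"
proof -
  obtain vs where vs: "set vs = V" "distinct vs" using finite_distinct_list[OF V(1)] by blast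
  define N where "N = length vs"
  have sum_vs: "(\<Sum>c<N. g (vs ! c)) = (\<Sum>x\<in>V. g x)" for g :: "'a \<Rightarrow> complex"
    using sum.reindex_bij_betw[OF bij_betw_nth[OF vs(2) refl refl], of g] vs(1) by (simp add: N_def)
  have vsV: "vs ! a \<in> V" if "a < N" for a using that vs(1) by (auto simp: N_def)
  have powV: "(\<phi> ^^ i) x \<in> V" if "x \<in> V" for i x
    using that permutes_in_image[OF V(2)] by (induction i) auto
  define M where "M = mat N N (\<lambda>(a, b). E (\<phi> (vs ! a)) (vs ! b))"
  have M: "M \<in> carrier_mat N N" by (simp add: M_def)
  have M_pow: "(M ^\<^sub>m Suc i) $$ (a, b) = E ((\<phi> ^^ Suc i) (vs ! a)) (vs ! b)" if "a < N" "b < N" for a b i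
    using that
  proof (induction i arbitrary: a b)
    case 0
    then show ?case by (simp add: M_def)
  next
    case (Suc i)
    let ?u = "(\<phi> ^^ Suc i) (vs ! a)" and ?y = "vs ! b"
    have u: "?u \<in> V" and y: "?y \<in> V" using powV vsV Suc.prems by blast+
    have "(M ^\<^sub>m Suc (Suc i)) $$ (a, b) = (\<Sum>c<N. (M ^\<^sub>m Suc i) $$ (a, c) * M $$ (c, b))"
      using Suc.prems M by (subst pow_mat.simps) (simp add: scalar_prod_def atLeast0LessThan del: pow_mat.simps)
    also have "\<dots> = (\<Sum>c<N. E ?u (vs ! c) * E (\<phi> (vs ! c)) ?y)"
      using Suc by (intro sum.cong refl) (simp add: M_def del: pow_mat.simps funpow.simps)
    also have "\<dots> = (\<Sum>z\<in>V. E ?u z * E (\<phi> z) ?y)" by (rule sum_vs)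
    also have "\<dots> = (\<Sum>z\<in>V. E (\<phi> ?u) (\<phi> z) * E (\<phi> z) ?y)"
      using u by (intro sum.cong refl) (simp add: inv del: funpow.simps)
    also have "\<dots> = (\<Sum>z\<in>V. E (\<phi> ?u) z * E z ?y)"
      by (rule sum.reindex_bij_betw[OF permutes_imp_bij[OF V(2)]])
    also have "\<dots> = E (\<phi> ?u) ?y"
      using u y by (intro idem) (simp_all add: permutes_in_image[OF V(2)] del: funpow.simps)
    finally show ?case by simp
  qed
  have "\<phi> ^^ Suc n = \<phi>" using n(2) by simp
  then have "(M ^\<^sub>m Suc n) $$ (a, b) = M $$ (a, b)" if "a < N" "b < N" for a b
    using that by (simp only: M_pow) (simp add: M_def)
  then have "M ^\<^sub>m Suc n = M"
    using M by (intro eq_matI) (simp_all del: pow_mat.simps)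
  from mat_trace_powers[OF M this] obtain es
    where tr: "\<And>i. mat_trace (M ^\<^sub>m i) = (\<Sum>e\<leftarrow>es. e ^ i)" and es: "\<And>e. e \<in> set es \<Longrightarrow> e ^ Suc n = e"
    by blast
  define \<alpha> where "\<alpha> = count_list es"
  have pos: "(\<Sum>x\<in>V. E ((\<phi> ^^ i) x) x) = char_sum n (\<lambda>z. int (\<alpha> z)) i" if i: "i > 0" for i
  proof -
    from i obtain i' where i': "i = Suc i'" by (cases i) auto
    have roots: "e ^ n = 1" if "e \<in> set es" "e \<noteq> 0" for e
      using es[OF that(1)] that(2) by simp
    have fin: "finite {z :: complex. z ^ n = 1}" using finite_roots_unity[of n] n(1) by simp
    have "(\<Sum>x\<in>V. E ((\<phi> ^^ i) x) x) = (\<Sum>c<N. (M ^\<^sub>m i) $$ (c, c))"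
      unfolding sum_vs[symmetric] i' by (intro sum.cong refl) (simp add: M_pow del: pow_mat.simps funpow.simps)
    also have "\<dots> = mat_trace (M ^\<^sub>m i)" using M by (simp add: mat_trace_def)
    also have "\<dots> = (\<Sum>e\<leftarrow>es. e ^ i)" by (rule tr)
    also have "\<dots> = (\<Sum>e\<in>set es. of_nat (\<alpha> e) * e ^ i)"
      unfolding \<alpha>_def by (rule sum_list_eq_sum_count_list[symmetric]) auto
    also have "\<dots> = (\<Sum>e\<in>set es \<union> {z. z ^ n = 1}. of_nat (\<alpha> e) * e ^ i)"
      by (rule sum.mono_neutral_left) (use fin in \<open>auto simp: \<alpha>_def count_list_0_iff\<close>)
    also have "\<dots> = (\<Sum>e | e ^ n = 1. of_nat (\<alpha> e) * e ^ i)"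
      by (rule sum.mono_neutral_right) (use fin roots i in \<open>auto simp: \<alpha>_def count_list_0_iff\<close>)
    finally show ?thesis by (simp add: char_sum_def)
  qed
  \<comment> \<open>At \<open>i = 0\<close> the trace of \<open>M ^\<^sub>m i\<close> also counts the eigenvalue \<open>0\<close>; use \<open>i = n\<close> instead.\<close>
  have "(\<Sum>x\<in>V. E ((\<phi> ^^ i) x) x) = char_sum n (\<lambda>z. int (\<alpha> z)) i" for i
  proof (cases "i = 0")
    case True
    have "(\<Sum>x\<in>V. E ((\<phi> ^^ n) x) x) = char_sum n (\<lambda>z. int (\<alpha> z)) n" by (rule pos[OF n(1)])
    then show ?thesis using True by (simp add: n(2) char_sum_def)
  qed (use pos in simp)
  then show ?thesis by blast
qed

section \<open>Strongly regular graphs\<close>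

lemma funpow_perm_order:
  assumes "permutation \<phi>"
  shows "perm_order \<phi> > 0 \<and> \<phi> ^^ perm_order \<phi> = id"
proof -
  obtain n where "\<phi> ^^ n = id" "n > 0"
    by (rule permutation_is_nilpotent[OF assms])
  then show ?thesis
    unfolding perm_order_def by (intro LeastI[of "\<lambda>n. 0 < n \<and> \<phi> ^^ n = id" n]) simp
qed

context
  fixes G :: "'a pair_pre_digraph" and v k l m :: nat
  assumes srg: "srg G v k l m"
begin

interpretation pair_graph G
  using srg by (simp add: srg_def)

abbreviation adj :: "'a \<Rightarrow> 'a \<Rightarrow> complex" where
  "adj x y \<equiv> of_bool ((x, y) \<in> parcs G)"

lemma srg_adj_sym: "(x, y) \<in> parcs G \<longleftrightarrow> (y, x) \<in> parcs G"
  using arcs_symmetric by auto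

lemma srg_irrefl: "(x, x) \<notin> parcs G"
proof
  assume "(x, x) \<in> parcs G"
  from no_loops[OF this] show False by simp
qed

lemma srg_finite: "finite (pverts G)" and srg_card: "card (pverts G) = v"
  using srg by (auto simp: srg_def)

lemma srg_order_pos: "v > 0"
proof -
  have "pverts G \<noteq> {}" using srg by (auto simp: srg_def)
  then show ?thesis using srg_finite srg_card card_gt_0_iff by metis
qed

lemma srg_degree:
  assumes "x \<in> pverts G"
  shows "(\<Sum>z\<in>pverts G. adj x z) = of_nat k" "(\<Sum>z\<in>pverts G. adj z x) = of_nat k"
proof -
  have "card {z \<in> pverts G. (x, z) \<in> parcs G} = k"
    using srg assms by (simp add: srg_def nbrs_def)
  then show 1: "(\<Sum>z\<in>pverts G. adj x z) = of_nat k"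
    using srg_finite by (simp add: of_bool_def sum.If_cases Int_def)
  then show "(\<Sum>z\<in>pverts G. adj z x) = of_nat k"
    by (simp add: srg_adj_sym[of _ x])
qed

text \<open>
  The entries of \<open>A\<^sup>2 = \<mu> J + (\<lambda> - \<mu>) A + (k - \<mu>) I\<close>, where \<open>J\<close> is the all-one matrix.
\<close>
lemma srg_common_neighbours:
  assumes xy: "x \<in> pverts G" "y \<in> pverts G"
  shows "(\<Sum>z\<in>pverts G. adj x z * adj z y)
    = of_nat m + (of_nat l - of_nat m) * adj x y + (of_nat k - of_nat m) * of_bool (x = y)"
proof -
  have "(\<Sum>z\<in>pverts G. adj x z * adj z y) = of_nat (card {z \<in> pverts G. (x, z) \<in> parcs G \<and> (z, y) \<in> parcs G})"
    using srg_finite by (simp add: Int_def flip: of_bool_conj)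
  also have "{z \<in> pverts G. (x, z) \<in> parcs G \<and> (z, y) \<in> parcs G} = nbrs G x \<inter> nbrs G y"
    by (auto simp: nbrs_def srg_adj_sym[of _ y])
  finally show ?thesis
    using srg xy srg_irrefl by (cases "x = y"; cases "(x, y) \<in> parcs G") (auto simp: srg_def)
qed

text \<open>
  The row sums of both sides of the previous identity.
\<close>
lemma srg_parameter_identity:
  "of_nat k * of_nat k = (of_nat v * of_nat m + (of_nat l - of_nat m) * of_nat k + (of_nat k - of_nat m) :: complex)"
proof -
  obtain x where x: "x \<in> pverts G" using srg by (auto simp: srg_def)
  have "of_nat k * of_nat k = (\<Sum>z\<in>pverts G. adj x z * of_nat k)"
    by (simp only: srg_degree(1)[OF x] flip: sum_distrib_right)
  also have "\<dots> = (\<Sum>z\<in>pverts G. adj x z * (\<Sum>y\<in>pverts G. adj z y))"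
    by (intro sum.cong refl) (simp only: srg_degree(1))
  also have "\<dots> = (\<Sum>y\<in>pverts G. \<Sum>z\<in>pverts G. adj x z * adj z y)"
    unfolding sum_distrib_left by (rule sum.swap)
  also have "\<dots> = (\<Sum>y\<in>pverts G. of_nat m + (of_nat l - of_nat m) * adj x y + (of_nat k - of_nat m) * of_bool (x = y))"
    using x by (intro sum.cong refl srg_common_neighbours)
  also have "\<dots> = of_nat v * of_nat m + (of_nat l - of_nat m) * of_nat k + (of_nat k - of_nat m)"
    using x srg_finite
    by (simp add: sum.distrib srg_card srg_degree[OF x] flip: sum_distrib_left del: sum_of_bool_eq)
      (simp add: of_bool_def)
  finally show ?thesis .
qed

text \<open>
  On the complement of the constant vectors \<open>A\<close> satisfies \<open>(A - \<theta>)(A - \<tau>) = 0\<close>. The projection onto the \<open>\<theta>\<close>-eigenspace in that complement is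
  \<open>E = (A - \<tau> I - c J) / (\<theta> - \<tau>)\<close>, with \<open>c = (k - \<tau>) / v\<close> chosen so that \<open>E\<close> kills the constant vectors.
  The trace of \<open>P\<^sup>i E\<close>, which is the character of \<open>\<phi>\<close> on the eigenspace, is then a combination of the
  numbers of vertices that \<open>\<phi>\<^sup>i\<close> fixes or moves to a neighbour.
\<close>
lemma srg_eigenspace_multiplicities:
  fixes \<theta> \<tau> :: int
  assumes \<phi>: "graph_aut G \<phi>" and n: "n > 0" "\<phi> ^^ n = id"
    and roots: "\<theta> + \<tau> = int l - int m" "\<theta> * \<tau> = int m - int k" "\<theta> \<noteq> \<tau>"
  shows "\<exists>\<alpha> :: complex \<Rightarrow> nat. \<forall>i. of_int (\<theta> - \<tau>) * char_sum n (\<lambda>z. int (\<alpha> z)) i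
    = of_int (int (card {x \<in> pverts G. ((\<phi> ^^ i) x, x) \<in> parcs G})
        - \<tau> * int (card {x \<in> pverts G. (\<phi> ^^ i) x = x}) - (int k - \<tau>))"
proof -
  define K M V a b where KMVab: "K = (of_nat k :: complex)" "M = (of_nat m :: complex)" "V = (of_nat v :: complex)"
    "a = (of_int \<theta> :: complex)" "b = (of_int \<tau> :: complex)"
  have L: "(of_nat l :: complex) - M = a + b"
    unfolding KMVab using arg_cong[OF roots(1), of "of_int :: int \<Rightarrow> complex"] by simp
  have ab: "K - M = - (a * b)"
    unfolding KMVab using arg_cong[OF roots(2), of "of_int :: int \<Rightarrow> complex"] by simp
  have s: "a - b \<noteq> 0" using roots(3) by (simp add: KMVab)
  have V0: "V \<noteq> 0" using srg_order_pos by (simp add: KMVab)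
  have VM: "V * M = (K - a) * (K - b)"
    using srg_parameter_identity L ab unfolding KMVab[symmetric] by (simp add: algebra_simps)
  define c where "c = (K - b) / V"
  have cV: "c * V = K - b" using V0 by (simp add: c_def)
  have Mc: "M = c * (K - a)" using VM V0 by (simp add: c_def field_simps)
  define E where "E x y = (adj x y - b * of_bool (x = y) - c) / (a - b)" for x y
  have perm: "\<phi> permutes pverts G" and arcs: "\<And>x y. x \<in> pverts G \<Longrightarrow> y \<in> pverts G
      \<Longrightarrow> (\<phi> x, \<phi> y) \<in> parcs G \<longleftrightarrow> (x, y) \<in> parcs G"
    using \<phi> by (auto simp: graph_aut_def)
  have "\<exists>\<alpha> :: complex \<Rightarrow> nat. \<forall>i. (\<Sum>x\<in>pverts G. E ((\<phi> ^^ i) x) x) = char_sum n (\<lambda>z. int (\<alpha> z)) i"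
  proof (rule invariant_idempotent_multiplicities[OF srg_finite perm n])
    fix x y assume xy: "x \<in> pverts G" "y \<in> pverts G"
    show "E (\<phi> x) (\<phi> y) = E x y"
      using xy permutes_inj[OF perm] by (simp add: E_def arcs inj_eq)
    have expand: "(\<Sum>z\<in>pverts G. (p z - b * d z - c) * (q z - b * e z - c))
        = (\<Sum>z\<in>pverts G. p z * q z) - b * (\<Sum>z\<in>pverts G. p z * e z)
          - b * (\<Sum>z\<in>pverts G. d z * q z) + b * b * (\<Sum>z\<in>pverts G. d z * e z)
          - c * (\<Sum>z\<in>pverts G. p z) - c * (\<Sum>z\<in>pverts G. q z)
          + c * b * (\<Sum>z\<in>pverts G. d z) + c * b * (\<Sum>z\<in>pverts G. e z) + c * (c * V)"
      for p d q e :: "'a \<Rightarrow> complex"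
      by (simp add: algebra_simps sum.distrib sum_subtractf sum_distrib_left srg_card KMVab(3))
    have "(\<Sum>z\<in>pverts G. (adj x z - b * of_bool (x = z) - c) * (adj z y - b * of_bool (z = y) - c))
        = (\<Sum>z\<in>pverts G. adj x z * adj z y) - b * (\<Sum>z\<in>pverts G. adj x z * of_bool (z = y))
          - b * (\<Sum>z\<in>pverts G. of_bool (x = z) * adj z y)
          + b * b * (\<Sum>z\<in>pverts G. of_bool (x = z) * of_bool (z = y))
          - c * (\<Sum>z\<in>pverts G. adj x z) - c * (\<Sum>z\<in>pverts G. adj z y)
          + c * b * (\<Sum>z\<in>pverts G. of_bool (x = z)) + c * b * (\<Sum>z\<in>pverts G. of_bool (z = y))
          + c * (c * V)"
      by (rule expand[of "adj x" "\<lambda>z. of_bool (x = z)" "\<lambda>z. adj z y" "\<lambda>z. of_bool (z = y)"])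
    also have "\<dots> = (M + (a + b) * adj x y - a * b * of_bool (x = y)) - b * adj x y
          - b * adj x y + b * b * of_bool (x = y)
          - c * K - c * K + c * b + c * b + c * (K - b)"
    proof -
      have pick: "(\<Sum>z\<in>pverts G. f z * of_bool (z = u)) = f u" "(\<Sum>z\<in>pverts G. of_bool (u = z) * f z) = f u"
        if "u \<in> pverts G" for f :: "'a \<Rightarrow> complex" and u
      proof -
        have "(\<Sum>z\<in>pverts G. f z * of_bool (z = u)) = (\<Sum>z\<in>pverts G. if z = u then f u else 0)"
          "(\<Sum>z\<in>pverts G. of_bool (u = z) * f z) = (\<Sum>z\<in>pverts G. if z = u then f u else 0)"
          by (intro sum.cong refl; simp)+
        moreover have "(\<Sum>z\<in>pverts G. if z = u then f u else 0) = f u"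
          using that srg_finite by simp
        ultimately show "(\<Sum>z\<in>pverts G. f z * of_bool (z = u)) = f u"
          "(\<Sum>z\<in>pverts G. of_bool (u = z) * f z) = f u" by (simp_all only:)
      qed
      have one: "(\<Sum>z\<in>pverts G. of_bool (x = z)) = (1 :: complex)"
        "(\<Sum>z\<in>pverts G. of_bool (z = y)) = (1 :: complex)"
        using pick(2)[OF xy(1), of "\<lambda>_. 1"] pick(1)[OF xy(2), of "\<lambda>_. 1"] by (simp_all only: mult_1 mult_1_right)
      show ?thesis
        unfolding pick(1)[OF xy(2)] pick(2)[OF xy(1)] one srg_degree(1)[OF xy(1)] srg_degree(2)[OF xy(2)]
          srg_common_neighbours[OF xy] cV KMVab(1,2)[symmetric] L ab
        by (simp only: mult_1_right minus_mult_left[symmetric] add_uminus_conv_diff)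
    qed
    also have "\<dots> = (a - b) * (adj x y - b * of_bool (x = y) - c)"
      using Mc by (simp add: algebra_simps)
    finally have eq: "(\<Sum>z\<in>pverts G. (adj x z - b * of_bool (x = z) - c) * (adj z y - b * of_bool (z = y) - c))
      = (a - b) * (adj x y - b * of_bool (x = y) - c)" .
    have "(\<Sum>z\<in>pverts G. E x z * E z y) = (\<Sum>z\<in>pverts G. (adj x z - b * of_bool (x = z) - c)
        * (adj z y - b * of_bool (z = y) - c)) / ((a - b) * (a - b))"
      by (simp add: E_def sum_divide_distrib)
    then show "(\<Sum>z\<in>pverts G. E x z * E z y) = E x y"
      unfolding eq using s by (simp add: E_def)
  qed
  then obtain \<alpha> :: "complex \<Rightarrow> nat" where
    \<alpha>: "\<And>i. (\<Sum>x\<in>pverts G. E ((\<phi> ^^ i) x) x) = char_sum n (\<lambda>z. int (\<alpha> z)) i"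
    by blast
  have "of_int (\<theta> - \<tau>) * char_sum n (\<lambda>z. int (\<alpha> z)) i
      = of_int (int (card {x \<in> pverts G. ((\<phi> ^^ i) x, x) \<in> parcs G})
        - \<tau> * int (card {x \<in> pverts G. (\<phi> ^^ i) x = x}) - (int k - \<tau>))" for i
  proof -
    have "of_int (\<theta> - \<tau>) * char_sum n (\<lambda>z. int (\<alpha> z)) i
        = (\<Sum>x\<in>pverts G. adj ((\<phi> ^^ i) x) x - b * of_bool ((\<phi> ^^ i) x = x) - c)"
    proof -
      have "(of_int (\<theta> - \<tau>) :: complex) = a - b" by (simp add: KMVab)
      then show ?thesis
        using s by (simp add: E_def flip: \<alpha> sum_divide_distrib)
    qed
    also have "\<dots> = (\<Sum>x\<in>pverts G. adj ((\<phi> ^^ i) x) x) - b * (\<Sum>x\<in>pverts G. of_bool ((\<phi> ^^ i) x = x)) - c * V"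
      by (simp add: sum_subtractf sum_distrib_left srg_card KMVab(3) mult.commute)
    also have "\<dots> = of_int (int (card {x \<in> pverts G. ((\<phi> ^^ i) x, x) \<in> parcs G})
        - \<tau> * int (card {x \<in> pverts G. (\<phi> ^^ i) x = x}) - (int k - \<tau>))"
      unfolding cV using srg_finite by (simp add: KMVab of_bool_def sum.If_cases Int_def)
    finally show ?thesis .
  qed
  then show ?thesis by blast
qed

text \<open>
  A pair of non-adjacent vertices gives \<open>\<mu> \<le> k\<close>. An adjacent pair \<open>u, w\<close> gives \<open>\<lambda> < k\<close>, since \<open>w\<close> is a neighbour
  of \<open>u\<close> but not a common one. So \<open>k = \<mu>\<close> and \<open>\<lambda> = \<mu>\<close> cannot both hold.
\<close>
lemma srg_discriminant_pos: "(int l - int m)\<^sup>2 + 4 * (int k - int m) > 0"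
proof -
  have fin: "finite (nbrs G x)" for x using srg_finite by (simp add: nbrs_def)
  obtain x y where "x \<in> pverts G" "y \<in> pverts G" "x \<noteq> y" "(x, y) \<notin> parcs G"
    using srg by (auto simp: srg_def)
  then have "card (nbrs G x \<inter> nbrs G y) = m" "card (nbrs G x) = k"
    using srg by (auto simp: srg_def)
  then have mk: "m \<le> k" using card_mono[OF fin, of "nbrs G x \<inter> nbrs G y" x] by simp
  obtain u w where uw: "(u, w) \<in> parcs G" using srg by (auto simp: srg_def)
  then have V: "u \<in> pverts G" "w \<in> pverts G" by (auto dest: in_arcsD1 in_arcsD2)
  have "card (nbrs G u \<inter> nbrs G w) < card (nbrs G u)"
  proof (rule psubset_card_mono[OF fin])
    have "w \<in> nbrs G u" "w \<notin> nbrs G w" using uw V srg_irrefl by (auto simp: nbrs_def)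
    then show "nbrs G u \<inter> nbrs G w \<subset> nbrs G u" by blast
  qed
  then have lk: "l < k" using srg uw V by (simp add: srg_def)
  show ?thesis
  proof (cases "k = m")
    case True
    then have "int l - int m \<noteq> 0" using lk by simp
    then show ?thesis using True by simp
  next
    case False
    then have "int k - int m > 0" using mk by simp
    then show ?thesis by (smt (verit) zero_le_power2)
  qed
qed

end

section \<open>The trace formula\<close>

lemma cycles_by_length:
  assumes V: "finite (pverts G)" "card (pverts G) = v" and perm: "\<phi> permutes pverts G"
  shows "(\<Sum>j | j \<in> {1..v} \<and> d dvd j. num_cycles_len G \<phi> j) = card {C \<in> perm_cycles G \<phi>. d dvd card C}"
proof -
  have fin: "finite (perm_cycles G \<phi>)" using V(1) by (simp add: perm_cycles_def)
  have perm': "permutation \<phi>" using V(1) perm by (auto simp: permutation_permutes)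
  have card: "card C \<in> {1..v}" if "C \<in> perm_cycles G \<phi>" for C
  proof -
    from that obtain x where x: "x \<in> pverts G" "C = orbit \<phi> x" by (auto simp: perm_cycles_def)
    have sub: "C \<subseteq> pverts G" using permutes_orbit_subset[OF perm x(1)] x(2) by simp
    have "x \<in> C" using permutation_self_in_orbit[OF perm'] x(2) by simp
    then have "card C > 0" using sub V(1) by (metis card_gt_0_iff empty_iff finite_subset)
    moreover have "card C \<le> v" using card_mono[OF V(1) sub] V(2) by simp
    ultimately show ?thesis by simp
  qed
  have "card {C \<in> perm_cycles G \<phi>. d dvd card C}
      = card (\<Union>j\<in>{j \<in> {1..v}. d dvd j}. {C \<in> perm_cycles G \<phi>. card C = j})"
    by (rule arg_cong[where f = card]) (use card in auto)
  also have "\<dots> = (\<Sum>j\<in>{j \<in> {1..v}. d dvd j}. card {C \<in> perm_cycles G \<phi>. card C = j})"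
    using fin by (intro card_UN_disjoint) auto
  finally show ?thesis by (simp add: num_cycles_len_def)
qed

theorem theorem2p1:
  fixes G :: "'a pair_pre_digraph"
    and v k l m n :: nat
    and vs :: "'a list"
    and \<nu>2 \<nu>3 \<Delta> :: int
    and \<phi> :: "'a \<Rightarrow> 'a"
  assumes "srg G v k l m"
    and "distinct vs" and "set vs = pverts G"
    and "spectrum (adjacency_mat G vs) = {of_nat k, of_int \<nu>2, of_int \<nu>3}"
    and "\<Delta> = (int l - int m)\<^sup>2 + 4 * (int k - int m)"
    and "real_of_int \<nu>2 = (real l - real m + sqrt (real_of_int \<Delta>)) / 2"
    and "real_of_int \<nu>3 = (real l - real m - sqrt (real_of_int \<Delta>)) / 2"
    and "graph_aut G \<phi>"
    and "perm_order \<phi> = n"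
  shows
    "(\<forall>r :: int. \<exists>a b :: nat \<Rightarrow> nat.
        int k - r
          + (\<Sum>d | d dvd n. int (a d) * moebius d * (\<nu>2 - r))
          + (\<Sum>d | d dvd n. int (b d) * moebius d * (\<nu>3 - r))
          = - r * int (num_fixed G \<phi>) + int (num_adj_image G \<phi>)
      \<and> int (a 1) + int (b 1) = int (num_cycles G \<phi>) - 1
      \<and> (\<forall>d. d dvd n \<and> d \<noteq> 1 \<longrightarrow>
            a d + b d = (\<Sum>j | j \<in> {1..v} \<and> d dvd j. num_cycles_len G \<phi> j)))
    \<and> (\<exists>s :: int. real_of_int s = sqrt (real_of_int \<Delta>)
        \<and> [int k - \<nu>3 = - \<nu>3 * int (num_fixed G \<phi>) + int (num_adj_image G \<phi>)] (mod s))"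
proof -
  note srg = assms(1)
  have fin: "finite (pverts G)" and card: "card (pverts G) = v"
    using srg_finite[OF srg] srg_card[OF srg] .
  have perm: "\<phi> permutes pverts G" using assms(8) by (simp add: graph_aut_def)
  then have perm': "permutation \<phi>" using fin by (auto simp: permutation_permutes)
  have n: "n > 0" "\<phi> ^^ n = id" using funpow_perm_order[OF perm'] assms(9) by auto
  have \<Delta>: "\<Delta> > 0" using srg_discriminant_pos[OF srg] assms(5) by simp
  define s where "s = \<nu>2 - \<nu>3"
  have s: "real_of_int s = sqrt (real_of_int \<Delta>)"
    unfolding s_def of_int_diff assms(6,7) by (simp add: field_simps)
  then have s0: "s \<noteq> 0" using \<Delta> by auto
  have "real_of_int (\<nu>2 + \<nu>3) = real_of_int (int l - int m)"
    unfolding of_int_add assms(6,7) by (simp add: field_simps)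
  then have sum: "\<nu>2 + \<nu>3 = int l - int m" by (simp only: of_int_eq_iff)
  have "real_of_int (s\<^sup>2) = real_of_int \<Delta>" using s \<Delta> by simp
  then have "s\<^sup>2 = \<Delta>" by (simp only: of_int_eq_iff)
  moreover have "4 * (\<nu>2 * \<nu>3) = (\<nu>2 + \<nu>3)\<^sup>2 - s\<^sup>2"
    by (simp add: s_def power2_eq_square algebra_simps)
  ultimately have prod: "\<nu>2 * \<nu>3 = int m - int k"
    unfolding sum assms(5) by simp

  \<comment> \<open>The characters of \<open>\<phi>\<close> on the two eigenspaces, with multiplicities \<open>\<alpha>\<close> and \<open>\<beta>\<close>.\<close>
  define fx where "fx i = int (card {x \<in> pverts G. (\<phi> ^^ i) x = x})" for i
  define ga where "ga i = int (card {x \<in> pverts G. ((\<phi> ^^ i) x, x) \<in> parcs G})" for i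
  have fx1: "fx 1 = int (num_fixed G \<phi>)" by (simp add: fx_def num_fixed_def)
  have ga1: "ga 1 = int (num_adj_image G \<phi>)"
    using srg_adj_sym[OF srg] by (simp add: ga_def num_adj_image_def)
  obtain \<alpha> :: "complex \<Rightarrow> nat" where
    \<alpha>: "\<And>i. of_int s * char_sum n (\<lambda>z. int (\<alpha> z)) i = of_int (ga i - \<nu>3 * fx i - (int k - \<nu>3))"
    using srg_eigenspace_multiplicities[OF srg assms(8) n sum prod] s0
    unfolding s_def fx_def ga_def by auto
  obtain \<beta> :: "complex \<Rightarrow> nat" where
    \<beta>: "\<And>i. of_int (- s) * char_sum n (\<lambda>z. int (\<beta> z)) i = of_int (ga i - \<nu>2 * fx i - (int k - \<nu>2))"
    using srg_eigenspace_multiplicities[OF srg assms(8) n, of \<nu>3 \<nu>2] sum prod s0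
    unfolding s_def fx_def ga_def by (auto simp: add.commute mult.commute)
  have s0': "(of_int s :: complex) \<noteq> 0" using s0 by simp
  have \<alpha>': "char_sum n (\<lambda>z. int (\<alpha> z)) i = of_int (ga i - \<nu>3 * fx i - (int k - \<nu>3)) / of_int s" for i
    using \<alpha>[of i] s0' by (simp add: field_simps)
  have \<beta>': "char_sum n (\<lambda>z. int (\<beta> z)) i = - (of_int (ga i - \<nu>2 * fx i - (int k - \<nu>2)) / of_int s)" for i
    using \<beta>[of i] s0' by (simp add: field_simps)
  have rat: "char_sum n (\<lambda>z. int (\<alpha> z)) i \<in> \<rat>" "char_sum n (\<lambda>z. int (\<beta> z)) i \<in> \<rat>" for i
    unfolding \<alpha>' \<beta>' by (intro Rats_divide Rats_minus_iff[THEN iffD2] Rats_of_int)+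
  define a where "a d = \<alpha> (cis (2 * pi / real d))" for d :: nat
  define b where "b d = \<beta> (cis (2 * pi / real d))" for d :: nat
  define A where "A = (\<Sum>d | d dvd n. int (a d) * moebius d)"
  define B where "B = (\<Sum>d | d dvd n. int (b d) * moebius d)"
  have "of_int (s * A) = (of_int (ga 1 - \<nu>3 * fx 1 - (int k - \<nu>3)) :: complex)"
    using \<alpha>[of 1] char_sum_1_eq_moebius_sum[OF n(1) rat(1)] by (simp add: A_def a_def)
  then have A: "s * A = ga 1 - \<nu>3 * fx 1 - (int k - \<nu>3)" by (simp only: of_int_eq_iff)
  have "of_int (- s * B) = (of_int (ga 1 - \<nu>2 * fx 1 - (int k - \<nu>2)) :: complex)"
    using \<beta>[of 1] char_sum_1_eq_moebius_sum[OF n(1) rat(2)] by (simp add: B_def b_def)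
  then have B: "- s * B = ga 1 - \<nu>2 * fx 1 - (int k - \<nu>2)" by (simp only: of_int_eq_iff)
  have trace: "int k - r + A * (\<nu>2 - r) + B * (\<nu>3 - r) = - r * fx 1 + ga 1" for r
  proof -
    have "s * (A * (\<nu>2 - r) + B * (\<nu>3 - r)) = (s * A) * (\<nu>2 - r) - (- s * B) * (\<nu>3 - r)"
      by (simp add: algebra_simps)
    also have "\<dots> = s * (- r * fx 1 + ga 1 - (int k - r))"
      unfolding A B by (simp add: s_def algebra_simps)
    finally show ?thesis using s0 by simp
  qed

  \<comment> \<open>The two eigenspaces and the constant vectors make up the permutation representation; the
    constant vectors account for the extra multiplicity of the eigenvalue \<open>1\<close>.\<close>
  have char_add: "char_sum n (\<lambda>z. int (\<alpha> z) + int (\<beta> z) + of_bool (z = 1)) i = of_int (fx i)" for i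
  proof -
    have "char_sum n (\<lambda>z. int (\<alpha> z) + int (\<beta> z) + of_bool (z = 1)) i
        = char_sum n (\<lambda>z. int (\<alpha> z)) i + char_sum n (\<lambda>z. int (\<beta> z)) i + 1"
    proof -
      have "of_int (int (\<alpha> z) + int (\<beta> z) + of_bool (z = 1)) * z ^ i
          = of_int (int (\<alpha> z)) * z ^ i + of_int (int (\<beta> z)) * z ^ i + (if z = 1 then 1 else 0)" for z :: complex
        by (cases "z = 1") (simp_all add: algebra_simps)
      then show ?thesis
        using finite_roots_unity[of n, where 'a = complex] n(1)
        by (simp only: char_sum_def sum.distrib) simp
    qed
    also have "\<dots> = of_int ((ga i - \<nu>3 * fx i - (int k - \<nu>3)) - (ga i - \<nu>2 * fx i - (int k - \<nu>2)) + s) / of_int s"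
      unfolding \<alpha>' \<beta>' using s0' by (simp add: field_simps)
    also have "(ga i - \<nu>3 * fx i - (int k - \<nu>3)) - (ga i - \<nu>2 * fx i - (int k - \<nu>2)) + s = fx i * s"
      by (simp add: s_def algebra_simps)
    finally show ?thesis using s0' by simp
  qed
  have count: "a d + b d + of_bool (d = 1) = card {C \<in> perm_cycles G \<phi>. d dvd card C}" if d: "d dvd n" for d
  proof -
    have d0: "d > 0" using d n(1) by (auto intro: Nat.gr0I)
    define w where "w = cis (2 * pi / real d)"
    have w: "w \<in> primitive_roots d" unfolding w_def by (rule cis_in_primitive_roots[OF d0])
    then have wn: "w ^ n = 1" using d by (simp add: primitive_rootsD)
    have w1: "w = 1 \<longleftrightarrow> d = 1" using primitive_rootsD[OF w, of 1] by simp
    have "of_nat n * of_int (int (\<alpha> w) + int (\<beta> w) + of_bool (w = 1))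
        = (\<Sum>i<n. of_int (fx i) * inverse w ^ i)"
      using char_sum_inversion[OF n(1) wn, of "\<lambda>z. int (\<alpha> z) + int (\<beta> z) + of_bool (z = 1)"]
      by (simp only: char_add)
    also have "\<dots> = of_nat n * of_nat (card {C \<in> perm_cycles G \<phi>. d dvd card C})"
      unfolding perm_cycles_def fx_def of_int_of_nat_eq by (rule fixed_points_inversion[OF fin perm n d w])
    finally have "(of_int (int (\<alpha> w) + int (\<beta> w) + of_bool (w = 1)) :: complex)
        = of_int (int (card {C \<in> perm_cycles G \<phi>. d dvd card C}))"
      using n(1) by simp
    then have "int (\<alpha> w) + int (\<beta> w) + of_bool (w = 1) = int (card {C \<in> perm_cycles G \<phi>. d dvd card C})"
      by (simp only: of_int_eq_iff)
    then show ?thesis unfolding a_def b_def w_def[symmetric] w1 by (cases "d = 1") simp_all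
  qed
  show ?thesis
  proof (intro conjI allI)
    fix r :: int
    show "\<exists>a b :: nat \<Rightarrow> nat.
        int k - r
          + (\<Sum>d | d dvd n. int (a d) * moebius d * (\<nu>2 - r))
          + (\<Sum>d | d dvd n. int (b d) * moebius d * (\<nu>3 - r))
          = - r * int (num_fixed G \<phi>) + int (num_adj_image G \<phi>)
      \<and> int (a 1) + int (b 1) = int (num_cycles G \<phi>) - 1
      \<and> (\<forall>d. d dvd n \<and> d \<noteq> 1 \<longrightarrow>
            a d + b d = (\<Sum>j | j \<in> {1..v} \<and> d dvd j. num_cycles_len G \<phi> j))"
    proof (rule exI[of _ a], rule exI[of _ b], intro conjI allI impI)
      show "int k - r + (\<Sum>d | d dvd n. int (a d) * moebius d * (\<nu>2 - r))
          + (\<Sum>d | d dvd n. int (b d) * moebius d * (\<nu>3 - r))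
          = - r * int (num_fixed G \<phi>) + int (num_adj_image G \<phi>)"
        using trace[of r] unfolding A_def B_def fx1 ga1 by (simp only: sum_distrib_right)
      show "int (a 1) + int (b 1) = int (num_cycles G \<phi>) - 1"
        using count[of 1] by (simp add: num_cycles_def)
      fix d assume "d dvd n \<and> d \<noteq> 1"
      then show "a d + b d = (\<Sum>j | j \<in> {1..v} \<and> d dvd j. num_cycles_len G \<phi> j)"
        using count[of d] by (simp only: cycles_by_length[OF fin card perm]) simp
    qed
  next
    have "(int k - \<nu>3) - (- \<nu>3 * fx 1 + ga 1) = s * (- A)"
      using A by (simp add: algebra_simps)
    then have "s dvd (int k - \<nu>3) - (- \<nu>3 * fx 1 + ga 1)" by (simp only: dvd_triv_left)
    then have "[int k - \<nu>3 = - \<nu>3 * int (num_fixed G \<phi>) + int (num_adj_image G \<phi>)] (mod s)"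
      by (simp only: cong_iff_dvd_diff fx1 ga1)
    with s show "\<exists>s :: int. real_of_int s = sqrt (real_of_int \<Delta>)
        \<and> [int k - \<nu>3 = - \<nu>3 * int (num_fixed G \<phi>) + int (num_adj_image G \<phi>)] (mod s)"
      by blast
  qed
qed

end
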